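(* Let $f,r,\phi=f+r$, the parameters $\bar\rho>\rho>0$, the step sizes $\{\alpha_t\}_{t\ge 0}$, the smoothed functions $f_{u_{1,t}}$, $\phi^{u,t}$, the Moreau envelopes $\phi_{1/\bar\rho}$, $\phi^{u,t}_{1/\bar\rho}$, the constant $\bar B$, and the random iterates $\{x_t\}_{t\ge 0}$ generated by the proximal stochastic derivative-free algorithm be as described in the context. Then there is a finite constant $B$, independent of $t$ (and of $T$), such that for every $t\ge 0$ \[ \mathbb{E}[\phi_{1/\bar{\rho}}(x_{t+1})] \le \mathbb{E}[\phi_{1/\bar\rho}(x_t)]+\alpha_t^2\bar B\sqrt{n+2}+\frac{B\bar\rho}{2}\alpha_t^2-\frac{\alpha_t(\bar\rho-\rho)}{2\bar\rho}\,\mathbb{E}\big[\|\nabla \phi^{u,t}_{1/\bar{\rho}}(x_t)\|^2\big], \] and consequently, for every $T\ge 0$, if $t^*\in\{0,\dots,T\}$ is sampled (independently of everything else) with $\mathbb{P}(t^*=t)=\alpha_t/\sum_{i=0}^T\alpha_i$, then \[ \mathbb{E}\big[\|\nabla \phi^{u,t^*}_{1/\bar{\rho}}(x_{t^*})\|^2\big] = \frac{1}{\sum_{t=0}^T \alpha_t} \sum_{t=0}^T \alpha_t\, \mathbb{E}\big[\|\nabla \phi^{u,t}_{1/\bar{\rho}}(x_t)\|^2\big] \le\frac{2\bar\rho}{\bar\rho-\rho}\cdot \frac{\phi^{u,0}(x_0)-\min \phi +\big(\bar B\sqrt{n+2}+\frac{B\bar\rho}{2}\big)\sum_{t=0}^T\alpha_t^2}{\sum_{t=0}^T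 \alpha_t}. \]
   Context: Norms and inner products are Euclidean on $\mathbb{R}^n$. Problem. Minimize $\phi(x)=f(x)+r(x)$ over $x\in\mathbb{R}^n$; the minimum $\min\phi$ is assumed to exist. Here $r:\mathbb{R}^n\to\mathbb{R}$ is convex (not necessarily differentiable). The function $f:\mathbb{R}^n\to\mathbb{R}$ (not necessarily differentiable) is $\rho$-weakly convex with $\rho>0$, i.e. $x\mapsto f(x)+\frac{\rho}{2}\|x\|^2$ is convex; equivalently $\langle v-w,x-y\rangle\ge-\rho\|x-y\|^2$ for all $x,y$ and all subgradients $v\in\partial f(x)$, $w\in\partial f(y)$. Moreover $f$ is locally Lipschitz with constant $L_0$ (every point of $\mathbb{R}^n$ has a neighbourhood on which $f$ is $L_0$-Lipschitz, with the same $L_0$). Only noisy values are available: $f(x)=\mathbb{E}_\xi[F(x;\xi)]$ with $\xi\sim P$. Smoothing. For $u>0$, $f_u(x)=\mathbb{E}[f(x+uz)]$ with $z\sim\mathcal N(0,I_n)$. Algorithm. Given a deterministic $x_0\in\mathbb{R}^n$ and a diminishing sequence of positive step sizes $\{\alpha_t\}_{t\ge0}$ (nonincreasing, $\alpha_t\to0$), put $u_{1,t}=\alpha_t^2$ and $u_{2,t}=\alpha_t^3$; it is required that $u_{2,t}\le u_{1,t}/2$. At iteration $t$, sample $\xi_t\sim P$, $Z_{1,t}\sim\mathcal N(0,I_n)$, $Z_{2,t}\sim\mathcal N(0,I_n)$, independently of each other and of the past, set \[ g_t=\frac{F(x_t+u_{1,t}Z_{1,t}+u_{2,t}Z_{2,t};\xi_t)-F(x_t+u_{1,t}Z_{1,t};\xi_t)}{u_{2,t}}\,Z_{2,t},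 \qquad x_{t+1}=\mathrm{prox}_{\alpha_t r}(x_t-\alpha_t g_t), \] where $\mathrm{prox}_{\alpha r}(x)=\mathrm{argmin}_y\{r(y)+\frac{1}{2\alpha}\|y-x\|^2\}$. Step size assumption. A number $\bar\rho>\rho$ is fixed and $\alpha_t<\min\{\frac1{\bar\rho},\frac{\bar\rho-\rho}{2}\}$ for all $t$. Standing properties of the estimator and of the smoothing. Let $\mathbb{E}_t$ denote conditional expectation given the history up to and including $x_t$. There are finite constants $E,\bar\sigma,\bar B>0$, independent of $t$, such that for all $t$: (i) $\mathbb{E}_t[g_t]=\nabla f_{u_{1,t}}(x_t)+\frac{u_{2,t}}{u_{1,t}}e_t$ with $\|e_t\|\le E$; (ii) $\mathbb{E}_t\|g_t-\nabla f_{u_{1,t}}(x_t)\|^2\le\bar\sigma$; (iii) $f(x)\le f_{u_{1,t}}(x)\le f(x)+u_{1,t}\bar B\sqrt{n+2}$ for all $x\in\mathbb{R}^n$. The constant $\bar B$ in the theorem is the one in (iii). Moreau envelopes. $\phi^{u,t}(x)=f_{u_{1,t}}(x)+r(x)$, and for $\lambda>0$, \[ \phi^{u,t}_{1/\lambda}(x)=\min_y\{\phi^{u,t}(y)+\tfrac{\lambda}{2}\|y-x\|^2\},\qquad \phi_{1/\lambda}(x)=\min_y\{\phi(y)+\tfrac{\lambda}{2}\|y-x\|^2\}. \] *)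

theory Defs
  imports "HOL-Probability.Probability"
begin

definition weakly_convex :: "real \<Rightarrow> ('a::real_inner \<Rightarrow> real) \<Rightarrow> bool" where
  "weakly_convex \<rho> f \<longleftrightarrow> convex_on UNIV (\<lambda>x. f x + \<rho> / 2 * (norm x)\<^sup>2)"

definition uniformly_locally_lipschitz :: "real \<Rightarrow> ('a::metric_space \<Rightarrow> real) \<Rightarrow> bool" where
  "uniformly_locally_lipschitz L f \<longleftrightarrow> (\<forall>x. \<exists>U. open U \<and> x \<in> U \<and> L-lipschitz_on U f)"

text \<open>Only meaningful where the function is differentiable; the gradient is then unique.\<close>

definition gradient :: "('a::real_inner \<Rightarrow> real) \<Rightarrow> 'a \<Rightarrow> 'a" where
  "gradient f x = (THE D. GDERIV f x :> D)"

definition prox :: "real \<Rightarrow> ('a::real_inner \<Rightarrow> real) \<Rightarrow> 'a \<Rightarrow> 'a" where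
  "prox \<alpha> r x = arg_min (\<lambda>y. r y + 1 / (2 * \<alpha>) * (norm (y - x))\<^sup>2) (\<lambda>_. True)"

text \<open>The envelope written with index \<open>1/\<mu>\<close> in the literature. The infimum is a minimum
  whenever the function is bounded below and continuous on a finite-dimensional space
  and \<open>\<mu> > 0\<close>.\<close>

definition moreau :: "real \<Rightarrow> ('a::real_inner \<Rightarrow> real) \<Rightarrow> 'a \<Rightarrow> real" where
  "moreau \<mu> h x = (INF y. h y + \<mu> / 2 * (norm (y - x))\<^sup>2)"

text \<open>The standard normal law \<open>N(0, I)\<close>: independent standard normal coordinates with respect
  to the orthonormal basis.\<close>

definition std_gaussian :: "'a::euclidean_space measure" where
  "std_gaussian = density lborel (\<lambda>z. ennreal (\<Prod>b\<in>Basis. std_normal_density (z \<bullet> b)))"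

definition gaussian_smoothing :: "real \<Rightarrow> ('a::euclidean_space \<Rightarrow> real) \<Rightarrow> 'a \<Rightarrow> real" where
  "gaussian_smoothing u f x = (\<integral>z. f (x + u *\<^sub>R z) \<partial>std_gaussian)"

text \<open>The \<open>\<sigma>\<close>-algebra generated by \<open>x 0, \<dots>, x t\<close>.\<close>

definition history :: "'w measure \<Rightarrow> (nat \<Rightarrow> 'w \<Rightarrow> 'a::topological_space) \<Rightarrow> nat \<Rightarrow> 'w measure" where
  "history M x t = vimage_algebra (space M) (\<lambda>\<omega>. \<lambda>s\<in>{..t}. x s \<omega>) (\<Pi>\<^sub>M s\<in>{..t}. borel)"

text \<open>The library's conditional expectation is scalar, so it is taken coordinatewise.\<close>

definition vec_cond_exp ::
    "'w measure \<Rightarrow> 'w measure \<Rightarrow> ('w \<Rightarrow> 'a::euclidean_space) \<Rightarrow> 'w \<Rightarrow> 'a" where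
  "vec_cond_exp M F X \<omega> = (\<Sum>b\<in>Basis. real_cond_exp M F (\<lambda>\<omega>'. X \<omega>' \<bullet> b) \<omega> *\<^sub>R b)"

end

theory Submission
  imports Defs
begin

text \<open>
  Write \<open>p\<close> for the proximal point of the smoothed objective \<open>fu t + r\<close> at \<open>x t\<close> with parameter
  \<open>\<rho>b\<close>, and \<open>d = x t - p\<close>. The gradient of the smoothed envelope at \<open>x t\<close> is \<open>\<rho>b *\<^sub>R d\<close>
  (\<open>gradient_moreau\<close>), so the theorem says that the envelope of \<open>f + r\<close> is a Lyapunov function
  which decreases in mean by a multiple of \<open>\<alpha> t * (norm d)\<^sup>2\<close>, up to errors of order \<open>(\<alpha> t)\<^sup>2\<close>.

  Since \<open>p\<close> competes in the infimum, the envelope of \<open>f + r\<close> at \<open>x (Suc t)\<close> is at most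
  \<open>f p + r p + \<rho>b / 2 * (norm (x (Suc t) - p))\<^sup>2\<close>, whereas the smoothed envelope at \<open>x t\<close> equals
  \<open>fu t p + r p + \<rho>b / 2 * (norm d)\<^sup>2\<close>. As \<open>f \<le> fu t\<close>, it suffices to see that a step contracts
  the squared distance to \<open>p\<close> in mean, up to an error of order \<open>(\<alpha> t)\<^sup>2\<close>. Stationarity of \<open>p\<close>
  makes it, too, a proximal point of \<open>\<alpha> t\<close> times \<open>r\<close> alone, taken at
  \<open>p + \<alpha> t *\<^sub>R (\<rho>b *\<^sub>R d - gradient (fu t) p)\<close>. As proximal maps of convex functions are
  nonexpansive, the new distance is at most the norm of
  \<open>(1 - \<alpha> t * \<rho>b) *\<^sub>R d - \<alpha> t *\<^sub>R (g t - gradient (fu t) p)\<close>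
  (\<open>prox_step_contraction\<close>). In its square, weak convexity bounds the gradient difference between
  \<open>x t\<close> and \<open>p\<close> against \<open>d\<close> from below by \<open>- \<rho> * (norm d)\<^sup>2\<close> (\<open>moreau_prox_step\<close>). The noise
  enters linearly only through its conditional mean, which is of size \<open>u2 t / u1 t = \<alpha> t\<close>, so that
  the linear term is of order \<open>(\<alpha> t)\<^sup>2\<close> and its part proportional to \<open>(norm d)\<^sup>2\<close> fits into the
  slack of the contraction. This gives \<open>B = E\<^sup>2 + 2 * \<sigma> + 8 * L0\<^sup>2\<close>
  (\<open>expected_moreau_descent\<close>). The smoothed envelope exceeds that of \<open>f + r\<close> by at most
  \<open>(\<alpha> t)\<^sup>2 * Bb * sqrt (n + 2)\<close>, where \<open>n\<close> is the dimension, and summing over \<open>t\<close> telescopes (\<open>weighted_average_le_of_descent\<close>).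

  Two points of analysis carry the argument. First, \<open>fu t\<close> must be differentiable although \<open>f\<close>
  need not be: a translation of the argument is moved into the Gaussian weight, which is smooth
  (\<open>gaussian_smoothing_gderiv\<close>). Second, all expectations must be shown to be finite along
  the iteration: since the objective is bounded below, \<open>(norm d)\<^sup>2\<close> is dominated by the envelope itself, so
  integrability of the envelope at \<open>x t\<close> yields square integrability of \<open>d\<close> and then, through the
  pathwise estimate, integrability of the envelope at \<open>x (Suc t)\<close>.
\<close>

section \<open>Weakly convex functions\<close>

lemma norm_convex_combination_sq:
  fixes x y :: "'a::real_inner"
  shows "(norm ((1 - s) *\<^sub>R x + s *\<^sub>R y))\<^sup>2
    = (1 - s) * (norm x)\<^sup>2 + s * (norm y)\<^sup>2 - s * (1 - s) * (norm (x - y))\<^sup>2"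
  unfolding power2_norm_eq_inner by (simp add: inner_simps inner_commute algebra_simps)

text \<open>Completing squares turns the definition into a convexity inequality with a defect term. The defect
depends only on the difference of the two points and is therefore invariant under translations; this
is what lets weak convexity pass through Gaussian averages.\<close>

lemma weakly_convex_iff:
  "weakly_convex \<eta> h \<longleftrightarrow> (\<forall>x y s. 0 < s \<longrightarrow> s < 1 \<longrightarrow>
     h ((1 - s) *\<^sub>R x + s *\<^sub>R y)
       \<le> (1 - s) * h x + s * h y + \<eta> / 2 * s * (1 - s) * (norm (x - y))\<^sup>2)"
  (is "_ \<longleftrightarrow> ?R")
proof
  assume "weakly_convex \<eta> h"
  then have c: "convex_on UNIV (\<lambda>x. h x + \<eta> / 2 * (norm x)\<^sup>2)" by (simp add: weakly_convex_def)
  show ?R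
  proof (intro allI impI)
    fix x y and s :: real assume "0 < s" "s < 1"
    then show "h ((1 - s) *\<^sub>R x + s *\<^sub>R y)
       \<le> (1 - s) * h x + s * h y + \<eta> / 2 * s * (1 - s) * (norm (x - y))\<^sup>2"
      using convex_onD[OF c, of s x y] unfolding norm_convex_combination_sq
      by (simp add: field_simps)
  qed
next
  assume ?R
  show "weakly_convex \<eta> h" unfolding weakly_convex_def
  proof (rule convex_onI)
    fix s :: real and x y assume "0 < s" "s < 1"
    then have "h ((1 - s) *\<^sub>R x + s *\<^sub>R y)
       \<le> (1 - s) * h x + s * h y + \<eta> / 2 * s * (1 - s) * (norm (x - y))\<^sup>2"
      using \<open>?R\<close> by blast
    then show "h ((1 - s) *\<^sub>R x + s *\<^sub>R y) + \<eta> / 2 * (norm ((1 - s) *\<^sub>R x + s *\<^sub>R y))\<^sup>2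
       \<le> (1 - s) * (h x + \<eta> / 2 * (norm x)\<^sup>2) + s * (h y + \<eta> / 2 * (norm y)\<^sup>2)"
      unfolding norm_convex_combination_sq by (simp add: field_simps)
  qed simp
qed

lemma weakly_convex_inequality:
  assumes "weakly_convex \<eta> h" "0 < s" "s < 1"
  shows "h ((1 - s) *\<^sub>R x + s *\<^sub>R y)
       \<le> (1 - s) * h x + s * h y + \<eta> / 2 * s * (1 - s) * (norm (x - y))\<^sup>2"
  using assms weakly_convex_iff by blast

lemma weakly_convex_add_convex:
  assumes "weakly_convex \<eta> f" "convex_on UNIV r"
  shows "weakly_convex \<eta> (\<lambda>y. f y + r y)"
  using convex_on_add[OF assms[unfolded weakly_convex_def]]
  unfolding weakly_convex_def by (simp add: ac_simps)

lemma convex_imp_weakly_convex_0: "convex_on UNIV r \<Longrightarrow> weakly_convex 0 r"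
  by (simp add: weakly_convex_def)

lemma weakly_convex_continuous:
  fixes h :: "'a::euclidean_space \<Rightarrow> real"
  assumes "weakly_convex \<eta> h"
  shows "continuous_on UNIV h"
proof -
  have "continuous_on UNIV (\<lambda>x. (h x + \<eta> / 2 * (norm x)\<^sup>2) - \<eta> / 2 * (norm x)\<^sup>2)"
    by (intro continuous_on_diff continuous_intros convex_on_continuous[OF open_UNIV]
        assms[unfolded weakly_convex_def])
  then show ?thesis by simp
qed

text \<open>On the unit ball \<open>q\<close> is bounded by continuity. Outside, the point where the segment from \<open>0\<close> to \<open>y\<close>
leaves the unit ball is a convex combination of the two ends, which prevents \<open>q y\<close> from dropping
faster than linearly. Adding a positive quadratic therefore makes \<open>q\<close> coercive.\<close>

lemma convex_ge_affine_norm: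
  fixes q :: "'a::euclidean_space \<Rightarrow> real"
  assumes q: "convex_on UNIV q"
  obtains K where "0 \<le> K" "\<And>y. - K * (1 + norm y) \<le> q y"
proof -
  have "continuous_on (cball 0 1) q"
    using convex_on_continuous[OF open_UNIV q] continuous_on_subset by blast
  then have "bounded (q ` cball 0 1)"
    using compact_cball compact_continuous_image compact_imp_bounded by blast
  then obtain K where K: "0 < K" "\<And>y. norm y \<le> 1 \<Longrightarrow> \<bar>q y\<bar> \<le> K"
    by (auto simp: bounded_pos)
  have "- (2 * K) * (1 + norm y) \<le> q y" for y
  proof (cases "norm y \<le> 1")
    case True
    have "2 * K * 1 \<le> 2 * K * (1 + norm y)" using K(1) by (intro mult_left_mono) auto
    then show ?thesis using K(2)[OF True] K(1) by linarith
  next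
    case False
    define s where "s = 1 / norm y"
    have "1 < norm y" using False by simp
    moreover from this have ny: "0 < norm y" by linarith
    ultimately have s: "0 < s" "s < 1" by (simp_all add: s_def divide_less_eq)
    have "q ((1 - s) *\<^sub>R 0 + s *\<^sub>R y) \<le> (1 - s) * q 0 + s * q y"
      using convex_onD[OF q, of s 0 y] s by simp
    moreover have "\<bar>q (s *\<^sub>R y)\<bar> \<le> K" using False by (intro K(2)) (simp add: s_def)
    moreover have "(1 - s) * q 0 \<le> (1 - s) * K" using K(2)[of 0] s by (intro mult_left_mono) auto
    moreover have "(1 - s) * K \<le> 1 * K" using s K(1) by (intro mult_right_mono) auto
    ultimately have "- (2 * K) \<le> s * q y" by simp
    then have "- (2 * K) * norm y \<le> q y" using ny by (simp add: s_def field_simps del: zero_less_norm_iff)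
    moreover have "- (2 * K) * (1 + norm y) \<le> - (2 * K) * norm y"
      using K(1) by (simp add: algebra_simps)
    ultimately show ?thesis by (rule order_trans[rotated])
  qed
  then show thesis using K(1) that[of "2 * K"] by simp
qed

section \<open>Gradients\<close>

lemma gradient_eqI:
  assumes "GDERIV f x :> D"
  shows "gradient f x = D"
  unfolding gradient_def
proof (rule the_equality)
  show "GDERIV f x :> D" by (rule assms)
  fix D' assume "GDERIV f x :> D'"
  then have "(\<lambda>h. h \<bullet> D') = (\<lambda>h. h \<bullet> D)"
    using assms unfolding gderiv_def by (rule has_derivative_unique)
  then have "(D' - D) \<bullet> D' = (D' - D) \<bullet> D" by (rule fun_cong)
  then have "(D' - D) \<bullet> (D' - D) = 0" by (simp add: inner_diff_right)
  then show "D' = D" by simp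
qed

text \<open>For the Moreau envelope and for the Gaussian smoothing a quadratic remainder comes out of an explicit
comparison, before anything is known about the derivative at other points.\<close>

lemma gderiv_if_quadratic_remainder:
  assumes "0 < \<delta>" and "\<And>k. norm k \<le> \<delta> \<Longrightarrow> \<bar>f (x + k) - f x - k \<bullet> D\<bar> \<le> C * (norm k)\<^sup>2"
  shows "GDERIV f x :> D"
  unfolding gderiv_def has_derivative_at
proof (intro conjI)
  show "bounded_linear (\<lambda>h. h \<bullet> D)" by (rule bounded_linear_inner_left)
  have lim: "((\<lambda>k::'a. \<bar>C\<bar> * norm k) \<longlongrightarrow> 0) (at 0)"
    by (intro tendsto_mult_right_zero tendsto_norm_zero tendsto_ident_at)
  have "eventually (\<lambda>k::'a. k \<noteq> 0 \<and> norm k \<le> \<delta>) (at 0)"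
    using assms(1) by (auto simp: eventually_at intro!: exI[of _ \<delta>])
  then have "eventually (\<lambda>k. norm (norm (f (x + k) - f x - k \<bullet> D) / norm k) \<le> \<bar>C\<bar> * norm k) (at 0)"
  proof (rule eventually_mono)
    fix k :: 'a assume k: "k \<noteq> 0 \<and> norm k \<le> \<delta>"
    have "\<bar>f (x + k) - f x - k \<bullet> D\<bar> \<le> C * (norm k)\<^sup>2" using assms(2) k by blast
    also have "\<dots> \<le> \<bar>C\<bar> * (norm k)\<^sup>2" by (intro mult_right_mono) auto
    finally show "norm (norm (f (x + k) - f x - k \<bullet> D) / norm k) \<le> \<bar>C\<bar> * norm k"
      using k by (simp add: field_simps power2_eq_square)
  qed
  then show "(\<lambda>k. norm (f (x + k) - f x - k \<bullet> D) / norm k) \<midarrow>0\<rightarrow> 0"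
    using lim by (rule Lim_null_comparison)
qed

lemma gderiv_line_derivative:
  assumes D: "GDERIV h x :> D"
  shows "((\<lambda>s. h (x + s *\<^sub>R v)) has_real_derivative v \<bullet> D) (at 0)"
proof -
  have "((\<lambda>s. x + s *\<^sub>R v) has_derivative (\<lambda>s. s *\<^sub>R v)) (at 0)"
    by (auto intro!: derivative_eq_intros)
  moreover have "(h has_derivative (\<lambda>k. k \<bullet> D)) (at (x + 0 *\<^sub>R v))" using D by (simp add: gderiv_def)
  ultimately have "((\<lambda>s. h (x + s *\<^sub>R v)) has_derivative (\<lambda>s. (s *\<^sub>R v) \<bullet> D)) (at 0)"
    by (rule has_derivative_compose)
  then show ?thesis by (simp add: has_field_derivative_def mult_commute_abs)
qed

text \<open>The difference quotient from \<open>x\<close> towards \<open>y\<close> is at most \<open>h y - h x\<close> plus the convexity defect;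
its limit at \<open>x\<close> is the directional derivative.\<close>

lemma weakly_convex_gradient_inequality:
  assumes wc: "weakly_convex \<eta> h" and D: "GDERIV h x :> D"
  shows "h x + (y - x) \<bullet> D - \<eta> / 2 * (norm (y - x))\<^sup>2 \<le> h y"
proof -
  have d: "((\<lambda>s. h (x + s *\<^sub>R (y - x))) has_real_derivative (y - x) \<bullet> D) (at 0)"
    by (rule gderiv_line_derivative[OF D])
  have "((\<lambda>s. (h (x + s *\<^sub>R (y - x)) - h x) / s) \<longlongrightarrow> (y - x) \<bullet> D) (at_right 0)"
    using d unfolding has_field_derivative_iff by (auto intro: filterlim_at_split[THEN iffD1, THEN conjunct2])
  moreover have "((\<lambda>s. h y - h x + \<eta> / 2 * (1 - s) * (norm (y - x))\<^sup>2)
      \<longlongrightarrow> h y - h x + \<eta> / 2 * (1 - 0) * (norm (y - x))\<^sup>2) (at_right 0)"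
    by (intro tendsto_intros)
  moreover have "eventually (\<lambda>s::real. 0 < s \<and> s < 1) (at_right 0)"
    using eventually_at_right_real[of 0 "1::real"] by (auto elim: eventually_mono)
  then have "eventually (\<lambda>s. (h (x + s *\<^sub>R (y - x)) - h x) / s
      \<le> h y - h x + \<eta> / 2 * (1 - s) * (norm (y - x))\<^sup>2) (at_right 0)"
  proof (rule eventually_mono)
    fix s :: real assume s: "0 < s \<and> s < 1"
    have eq: "(1 - s) *\<^sub>R x + s *\<^sub>R y = x + s *\<^sub>R (y - x)" by (simp add: algebra_simps)
    have "h (x + s *\<^sub>R (y - x)) - h x \<le> s * (h y - h x + \<eta> / 2 * (1 - s) * (norm (y - x))\<^sup>2)"
      using weakly_convex_inequality[OF wc, of s x y] s unfolding eq norm_minus_commute[of x y]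
      by (simp add: field_simps)
    then show "(h (x + s *\<^sub>R (y - x)) - h x) / s
      \<le> h y - h x + \<eta> / 2 * (1 - s) * (norm (y - x))\<^sup>2"
      using s by (simp add: divide_le_eq mult.commute)
  qed
  ultimately have "(y - x) \<bullet> D \<le> h y - h x + \<eta> / 2 * (1 - 0) * (norm (y - x))\<^sup>2"
    by (intro tendsto_le) auto
  then show ?thesis by simp
qed

lemma weakly_convex_gradient_monotone:
  assumes wc: "weakly_convex \<eta> h" and "GDERIV h x :> Dx" "GDERIV h y :> Dy"
  shows "- \<eta> * (norm (x - y))\<^sup>2 \<le> (x - y) \<bullet> (Dx - Dy)"
proof -
  have "(norm (x - y))\<^sup>2 = (norm (y - x))\<^sup>2" by (simp add: norm_minus_commute)
  then show ?thesis
    using weakly_convex_gradient_inequality[OF wc assms(2), of y]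
      weakly_convex_gradient_inequality[OF wc assms(3), of x]
    by (simp add: inner_simps algebra_simps)
qed

text \<open>Along the direction \<open>D\<close> itself the derivative is \<open>(norm D)\<^sup>2\<close>, whereas the Lipschitz condition
allows at most \<open>L * norm D\<close>.\<close>

lemma norm_gradient_le_lipschitz:
  assumes "0 \<le> L" and lip: "\<And>y. \<bar>h y - h x\<bar> \<le> L * norm (y - x)" and D: "GDERIV h x :> D"
  shows "norm D \<le> L"
proof -
  have "((\<lambda>s. h (x + s *\<^sub>R D)) has_real_derivative D \<bullet> D) (at 0)"
    by (rule gderiv_line_derivative[OF D])
  then have "((\<lambda>s. (h (x + s *\<^sub>R D) - h x) / s) \<longlongrightarrow> D \<bullet> D) (at_right 0)"
    unfolding has_field_derivative_iff by (auto intro: filterlim_at_split[THEN iffD1, THEN conjunct2])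
  moreover have "eventually (\<lambda>s. (h (x + s *\<^sub>R D) - h x) / s \<le> L * norm D) (at_right 0)"
  proof (rule eventually_at_right_less[THEN eventually_mono])
    fix s :: real assume "0 < s"
    then show "(h (x + s *\<^sub>R D) - h x) / s \<le> L * norm D"
      using lip[of "x + s *\<^sub>R D"] by (simp add: field_simps)
  qed
  ultimately have "D \<bullet> D \<le> L * norm D"
    by (intro tendsto_upperbound) auto
  then have "norm D * norm D \<le> L * norm D" by (simp add: norm_eq_sqrt_inner)
  then show ?thesis using assms(1) by (cases "D = 0") auto
qed

section \<open>Proximal points and Moreau envelopes\<close>

text \<open>The objective splits into the convex function \<open>h y + \<eta> / 2 * (norm y)\<^sup>2\<close>, which decreases at most
linearly, and a quadratic with the positive leading coefficient \<open>(\<mu> - \<eta>) / 2\<close>. So far away it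
exceeds its value at \<open>0\<close>, and a minimizer on a large ball is a global one.\<close>

lemma prox_objective_has_minimizer:
  fixes h :: "'a::euclidean_space \<Rightarrow> real"
  assumes wc: "weakly_convex \<eta> h" and mu: "\<eta> < \<mu>" "0 < \<mu>"
  shows "\<exists>p. \<forall>y. h p + \<mu> / 2 * (norm (p - x))\<^sup>2 \<le> h y + \<mu> / 2 * (norm (y - x))\<^sup>2"
proof -
  define k where "k y = h y + \<mu> / 2 * (norm (y - x))\<^sup>2" for y
  define c where "c = \<mu> - \<eta>"
  have c: "0 < c" using mu by (simp add: c_def)
  obtain K where K: "0 \<le> K" "\<And>y. - K * (1 + norm y) \<le> h y + \<eta> / 2 * (norm y)\<^sup>2"
    using convex_ge_affine_norm[OF wc[unfolded weakly_convex_def]] by blast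
  define A where "A = K + \<mu> * norm x"
  \<comment> \<open>Beyond this radius the quadratic term dominates the linear one by more than \<open>\<bar>k 0\<bar> * norm y\<close>.\<close>
  define R where "R = max 1 (2 * (A + K + \<bar>k 0\<bar> + 1) / c)"
  have A0: "0 \<le> A" using K mu by (simp add: A_def)
  have lower: "- K - A * norm y + c / 2 * (norm y)\<^sup>2 \<le> k y" for y
  proof -
    have "\<mu> * (y \<bullet> x) \<le> \<mu> * (norm y * norm x)"
      using mu norm_cauchy_schwarz[of y x] by (intro mult_left_mono) auto
    moreover have "\<mu> / 2 * (norm (y - x))\<^sup>2 = \<mu> / 2 * (norm y)\<^sup>2 - \<mu> * (y \<bullet> x) + \<mu> / 2 * (norm x)\<^sup>2"
      by (simp add: power2_norm_eq_inner inner_simps inner_commute field_simps)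
    moreover have "0 \<le> \<mu> / 2 * (norm x)\<^sup>2" using mu by simp
    ultimately show ?thesis using K(2)[of y] by (simp add: k_def A_def c_def algebra_simps)
  qed
  have far: "k 0 \<le> k y" if "R \<le> norm y" for y
  proof -
    let ?D = "A + K + \<bar>k 0\<bar> + 1"
    have y: "1 \<le> norm y" "?D \<le> c / 2 * norm y"
      using that c by (auto simp: R_def field_simps)
    have "?D * norm y \<le> (c / 2 * norm y) * norm y" using y by (intro mult_right_mono) auto
    moreover have "(K + \<bar>k 0\<bar> + 1) * 1 \<le> (K + \<bar>k 0\<bar> + 1) * norm y"
      using y K by (intro mult_left_mono) auto
    ultimately show ?thesis using lower[of y] by (simp add: power2_eq_square algebra_simps)
  qed
  have "continuous_on (cball 0 R) k"
    unfolding k_def using weakly_convex_continuous[OF wc] 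
    by (intro continuous_intros) (auto intro: continuous_on_subset)
  moreover have "cball (0::'a) R \<noteq> {}" by (auto simp: R_def)
  ultimately obtain p where p: "p \<in> cball 0 R" "\<And>y. y \<in> cball 0 R \<Longrightarrow> k p \<le> k y"
    using continuous_attains_inf[of "cball 0 R" k] by auto
  have "k p \<le> k y" for y
  proof (cases "norm y \<le> R")
    case True then show ?thesis using p(2)[of y] by simp
  next
    case False
    moreover have "k p \<le> k 0" using p(2)[of 0] by (simp add: R_def)
    ultimately show ?thesis using far[of y] by simp
  qed
  then show ?thesis unfolding k_def by blast
qed

lemma prox_minimizes:
  fixes h :: "'a::euclidean_space \<Rightarrow> real"
  assumes wc: "weakly_convex \<eta> h" and mu: "\<eta> < \<mu>" "0 < \<mu>"
  shows "h (prox (1 / \<mu>) h x) + \<mu> / 2 * (norm (prox (1 / \<mu>) h x - x))\<^sup>2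
    \<le> h y + \<mu> / 2 * (norm (y - x))\<^sup>2"
proof -
  let ?k = "\<lambda>y. h y + 1 / (2 * (1 / \<mu>)) * (norm (y - x))\<^sup>2"
  have "\<exists>p. is_arg_min ?k (\<lambda>_. True) p"
    using prox_objective_has_minimizer[OF assms, of x] by (simp add: is_arg_min_linorder)
  then have "is_arg_min ?k (\<lambda>_. True) (prox (1 / \<mu>) h x)"
    unfolding prox_def arg_min_def by (rule someI_ex)
  then show ?thesis by (simp add: is_arg_min_linorder)
qed

text \<open>Minimality is tested against a point a fraction \<open>s\<close> of the way from \<open>p\<close> to \<open>y\<close>. The objective is
strongly convex with modulus \<open>\<mu> - \<eta>\<close>, so after division by \<open>s\<close> a quadratic gain remains as \<open>s\<close>
tends to \<open>0\<close>. In particular the minimizer is unique.\<close>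

lemma prox_quadratic_growth:
  fixes h :: "'a::euclidean_space \<Rightarrow> real" and x :: 'a
  assumes wc: "weakly_convex \<eta> h" and mu: "\<eta> < \<mu>" "0 < \<mu>"
  defines "p \<equiv> prox (1 / \<mu>) h x"
  shows "h p + \<mu> / 2 * (norm (p - x))\<^sup>2 + (\<mu> - \<eta>) / 2 * (norm (y - p))\<^sup>2
    \<le> h y + \<mu> / 2 * (norm (y - x))\<^sup>2"
proof -
  define k where "k y = h y + \<mu> / 2 * (norm (y - x))\<^sup>2" for y
  have *: "(\<mu> - \<eta>) / 2 * (1 - s) * (norm (y - p))\<^sup>2 \<le> k y - k p" if s: "0 < s" "s < 1" for s
  proof -
    have eq: "(1 - s) *\<^sub>R p + s *\<^sub>R y - x = (1 - s) *\<^sub>R (p - x) + s *\<^sub>R (y - x)"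
      by (simp add: algebra_simps)
    have "k p \<le> k ((1 - s) *\<^sub>R p + s *\<^sub>R y)"
      unfolding k_def p_def by (rule prox_minimizes[OF assms(1-3)])
    also have "\<dots> \<le> (1 - s) * k p + s * k y - (\<mu> - \<eta>) / 2 * s * (1 - s) * (norm (p - y))\<^sup>2"
      using weakly_convex_inequality[OF wc s, of p y]
      unfolding k_def eq norm_convex_combination_sq by (simp add: field_simps)
    finally have "s * ((\<mu> - \<eta>) / 2 * (1 - s) * (norm (y - p))\<^sup>2) \<le> s * (k y - k p)"
      by (simp add: algebra_simps norm_minus_commute)
    then show ?thesis using s by simp
  qed
  have "((\<lambda>s. (\<mu> - \<eta>) / 2 * (1 - s) * (norm (y - p))\<^sup>2)
      \<longlongrightarrow> (\<mu> - \<eta>) / 2 * (1 - 0) * (norm (y - p))\<^sup>2) (at_right 0)"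
    by (intro tendsto_intros)
  moreover have "eventually (\<lambda>s::real. 0 < s \<and> s < 1) (at_right 0)"
    using eventually_at_right_real[of 0 "1::real"] by (auto elim: eventually_mono)
  then have "eventually (\<lambda>s. (\<mu> - \<eta>) / 2 * (1 - s) * (norm (y - p))\<^sup>2 \<le> k y - k p) (at_right 0)"
    by (rule eventually_mono) (use * in blast)
  ultimately have "(\<mu> - \<eta>) / 2 * (1 - 0) * (norm (y - p))\<^sup>2 \<le> k y - k p"
    by (intro tendsto_upperbound) auto
  then show ?thesis by (simp add: k_def)
qed

text \<open>Adding the growth estimates at the two proximal points cancels all values of \<open>h\<close> and leaves an
inequality between inner products.\<close>

lemma prox_lipschitz:
  fixes h :: "'a::euclidean_space \<Rightarrow> real"
  assumes wc: "weakly_convex \<eta> h" and mu: "\<eta> < \<mu>" "0 < \<mu>"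
  shows "norm (prox (1 / \<mu>) h x - prox (1 / \<mu>) h y) \<le> \<mu> / (\<mu> - \<eta>) * norm (x - y)"
proof -
  define p where "p = prox (1 / \<mu>) h x"
  define q where "q = prox (1 / \<mu>) h y"
  have "h p + \<mu> / 2 * (norm (p - x))\<^sup>2 + (\<mu> - \<eta>) / 2 * (norm (q - p))\<^sup>2
      \<le> h q + \<mu> / 2 * (norm (q - x))\<^sup>2"
    "h q + \<mu> / 2 * (norm (q - y))\<^sup>2 + (\<mu> - \<eta>) / 2 * (norm (p - q))\<^sup>2
      \<le> h p + \<mu> / 2 * (norm (p - y))\<^sup>2"
    unfolding p_def q_def by (rule prox_quadratic_growth[OF assms])+
  then have "(\<mu> - \<eta>) * (norm (p - q))\<^sup>2 \<le> \<mu> / 2 * ((norm (q - x))\<^sup>2 - (norm (p - x))\<^sup>2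
      + (norm (p - y))\<^sup>2 - (norm (q - y))\<^sup>2)"
    by (simp add: field_simps norm_minus_commute)
  also have "\<dots> = \<mu> * ((p - q) \<bullet> (x - y))"
    by (simp add: power2_norm_eq_inner inner_simps inner_commute algebra_simps)
  also have "\<dots> \<le> \<mu> * (norm (p - q) * norm (x - y))"
    using mu norm_cauchy_schwarz by (intro mult_left_mono) auto
  finally have "norm (p - q) * ((\<mu> - \<eta>) * norm (p - q)) \<le> norm (p - q) * (\<mu> * norm (x - y))"
    by (simp add: power2_eq_square algebra_simps)
  then have "(\<mu> - \<eta>) * norm (p - q) \<le> \<mu> * norm (x - y)"
    using mu by (cases "p = q") (auto simp: mult_le_cancel_left)
  then show ?thesis using mu by (simp add: p_def q_def field_simps)
qed

lemma prox_continuous: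
  fixes h :: "'a::euclidean_space \<Rightarrow> real"
  assumes "weakly_convex \<eta> h" and "\<eta> < \<mu>" "0 < \<mu>"
  shows "continuous_on UNIV (prox (1 / \<mu>) h)"
proof -
  have "(\<mu> / (\<mu> - \<eta>))-lipschitz_on UNIV (prox (1 / \<mu>) h)"
    using prox_lipschitz[OF assms] assms by (intro lipschitz_onI) (auto simp: dist_norm)
  then show ?thesis by (rule lipschitz_on_continuous_on)
qed

lemma moreau_eq_prox:
  fixes h :: "'a::euclidean_space \<Rightarrow> real"
  assumes "weakly_convex \<eta> h" and "\<eta> < \<mu>" "0 < \<mu>"
  shows "moreau \<mu> h x = h (prox (1 / \<mu>) h x) + \<mu> / 2 * (norm (prox (1 / \<mu>) h x - x))\<^sup>2"
  unfolding moreau_def using prox_minimizes[OF assms]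
  by (intro cInf_eq_minimum) auto

lemma moreau_le:
  fixes h :: "'a::euclidean_space \<Rightarrow> real"
  assumes "weakly_convex \<eta> h" and "\<eta> < \<mu>" "0 < \<mu>"
  shows "moreau \<mu> h x \<le> h y + \<mu> / 2 * (norm (y - x))\<^sup>2"
  unfolding moreau_eq_prox[OF assms] by (rule prox_minimizes[OF assms])

text \<open>Using the proximal point of \<open>x\<close> as a competitor at \<open>x + k\<close> gives the upper half of a quadratic
estimate. The lower half is the same bound with the two points exchanged; the proximal point then in
question differs from that of \<open>x\<close> by \<open>O(norm k)\<close> only.\<close>

lemma gderiv_moreau:
  fixes h :: "'a::euclidean_space \<Rightarrow> real"
  assumes "weakly_convex \<eta> h" and "\<eta> < \<mu>" "0 < \<mu>"
  shows "GDERIV (moreau \<mu> h) x :> \<mu> *\<^sub>R (x - prox (1 / \<mu>) h x)"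
proof (rule gderiv_if_quadratic_remainder[where \<delta> = 1 and C = "\<mu> / 2 + \<mu> * (\<mu> / (\<mu> - \<eta>))"])
  show "(0::real) < 1" by simp
next
  let ?p = "prox (1 / \<mu>) h"
  have up: "moreau \<mu> h (x + k) \<le> moreau \<mu> h x + k \<bullet> (\<mu> *\<^sub>R (x - ?p x)) + \<mu> / 2 * (norm k)\<^sup>2" for x k
  proof -
    have "moreau \<mu> h (x + k) \<le> h (?p x) + \<mu> / 2 * (norm (?p x - (x + k)))\<^sup>2"
      by (rule moreau_le[OF assms])
    then show ?thesis unfolding moreau_eq_prox[OF assms, of x]
      by (simp add: power2_norm_eq_inner inner_simps inner_commute algebra_simps)
  qed
  fix k :: 'a
  let ?y = "x + k"
  have "moreau \<mu> h x \<le> moreau \<mu> h ?y + (-k) \<bullet> (\<mu> *\<^sub>R (?y - ?p ?y)) + \<mu> / 2 * (norm k)\<^sup>2"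
    using up[of ?y "-k"] by simp
  also have "\<dots> = moreau \<mu> h ?y - k \<bullet> (\<mu> *\<^sub>R (x - ?p x)) + \<mu> * (k \<bullet> (?p ?y - ?p x)) - \<mu> / 2 * (norm k)\<^sup>2"
    by (simp add: power2_norm_eq_inner inner_simps inner_commute algebra_simps)
  also have "\<mu> * (k \<bullet> (?p ?y - ?p x)) \<le> \<mu> * (norm k * (\<mu> / (\<mu> - \<eta>) * norm k))"
  proof (rule mult_left_mono)
    have "k \<bullet> (?p ?y - ?p x) \<le> norm k * norm (?p ?y - ?p x)" by (rule norm_cauchy_schwarz)
    also have "\<dots> \<le> norm k * (\<mu> / (\<mu> - \<eta>) * norm k)"
      using prox_lipschitz[OF assms, of ?y x] by (intro mult_left_mono) auto
    finally show "k \<bullet> (?p ?y - ?p x) \<le> norm k * (\<mu> / (\<mu> - \<eta>) * norm k)" .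
  qed (use assms in simp)
  finally have lo: "moreau \<mu> h x \<le> moreau \<mu> h ?y - k \<bullet> (\<mu> *\<^sub>R (x - ?p x))
      + \<mu> * (\<mu> / (\<mu> - \<eta>)) * (norm k)\<^sup>2 - \<mu> / 2 * (norm k)\<^sup>2"
    by (simp add: power2_eq_square algebra_simps)
  have "0 \<le> \<mu> * (\<mu> / (\<mu> - \<eta>)) * (norm k)\<^sup>2" "0 \<le> \<mu> / 2 * (norm k)\<^sup>2" using assms by simp_all
  then show "\<bar>moreau \<mu> h (x + k) - moreau \<mu> h x - k \<bullet> (\<mu> *\<^sub>R (x - ?p x))\<bar>
      \<le> (\<mu> / 2 + \<mu> * (\<mu> / (\<mu> - \<eta>))) * (norm k)\<^sup>2"
    using lo up[of x k] unfolding distrib_right abs_le_iff by linarith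
qed

lemma gradient_moreau:
  fixes h :: "'a::euclidean_space \<Rightarrow> real"
  assumes "weakly_convex \<eta> h" and "\<eta> < \<mu>" "0 < \<mu>"
  shows "gradient (moreau \<mu> h) x = \<mu> *\<^sub>R (x - prox (1 / \<mu>) h x)"
  by (rule gradient_eqI[OF gderiv_moreau[OF assms]])

lemma gradient_moreau_measurable:
  fixes h :: "'a::euclidean_space \<Rightarrow> real"
  assumes "weakly_convex \<eta> h" and "\<eta> < \<mu>" "0 < \<mu>"
  shows "gradient (moreau \<mu> h) \<in> borel_measurable borel"
proof -
  have [measurable]: "prox (1 / \<mu>) h \<in> borel_measurable borel"
    by (rule borel_measurable_continuous_onI[OF prox_continuous[OF assms]])
  have "gradient (moreau \<mu> h) = (\<lambda>x. \<mu> *\<^sub>R (x - prox (1 / \<mu>) h x))"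
    using gradient_moreau[OF assms] by blast
  then show ?thesis by simp
qed

section \<open>Lipschitz functions\<close>

text \<open>The constant is the same near every point, so local bounds on short subintervals of the segment from
\<open>x\<close> to \<open>y\<close> add up without loss; bisection of the segment organizes this.\<close>

lemma uniformly_locally_lipschitz_imp_lipschitz:
  fixes f :: "'a::real_normed_vector \<Rightarrow> real"
  assumes "uniformly_locally_lipschitz L f"
  shows "\<bar>f y - f x\<bar> \<le> L * norm (y - x)"
proof -
  define c where "c s = x + s *\<^sub>R (y - x)" for s :: real
  define P where "P a b \<longleftrightarrow> \<bar>f (c b) - f (c a)\<bar> \<le> L * ((b - a) * norm (y - x))" for a b
  have "P 0 1"
  proof (rule Bolzano)
    fix a b d assume "P a b" "P b d"
    moreover have "L * ((d - a) * norm (y - x)) = L * ((b - a) * norm (y - x)) + L * ((d - b) * norm (y - x))"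
      by (simp add: algebra_simps)
    ultimately show "P a d" unfolding P_def by simp
  next
    fix s :: real
    obtain U where U: "open U" "c s \<in> U" "L-lipschitz_on U f"
      using assms unfolding uniformly_locally_lipschitz_def by blast
    have "isCont c s" unfolding c_def by (intro continuous_intros)
    then have "eventually (\<lambda>s'. c s' \<in> U) (nhds s)"
      using U unfolding isCont_def tendsto_at_iff_tendsto_nhds by (auto simp: tendsto_def)
    then obtain d where d: "0 < d" "\<And>s'. dist s' s < d \<Longrightarrow> c s' \<in> U"
      by (auto simp: eventually_nhds_metric)
    have "P a b" if ab: "a \<le> s \<and> s \<le> b \<and> b - a < d" for a b
    proof -
      have "c a \<in> U" "c b \<in> U" using ab by (auto intro!: d(2) simp: dist_real_def)
      then have "dist (f (c b)) (f (c a)) \<le> L * dist (c b) (c a)"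
        using U(3) lipschitz_onD by blast
      moreover have "c b - c a = (b - a) *\<^sub>R (y - x)" by (simp add: c_def algebra_simps)
      ultimately show ?thesis
        using ab by (simp add: P_def dist_norm dist_real_def)
    qed
    then show "\<exists>d>0. \<forall>a b. a \<le> s \<and> s \<le> b \<and> b - a < d \<longrightarrow> P a b" using d(1) by blast
  qed simp
  then show ?thesis by (simp add: P_def c_def)
qed

lemma uniformly_locally_lipschitz_nonneg:
  "uniformly_locally_lipschitz L f \<Longrightarrow> 0 \<le> L"
  unfolding uniformly_locally_lipschitz_def using lipschitz_on_nonneg by blast

section \<open>The standard Gaussian measure\<close>

definition gaussian_density :: "'a::euclidean_space \<Rightarrow> real" where
  "gaussian_density z = (\<Prod>b\<in>Basis. std_normal_density (z \<bullet> b))"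

lemma std_gaussian_eq: "std_gaussian = density lborel (\<lambda>z. ennreal (gaussian_density z))"
  by (simp add: std_gaussian_def gaussian_density_def)

lemma norm_sq_eq_sum_Basis: "(norm z)\<^sup>2 = (\<Sum>b\<in>Basis. (z \<bullet> b)\<^sup>2)"
  for z :: "'a::euclidean_space"
  unfolding power2_norm_eq_inner euclidean_inner[of z z] by (simp add: power2_eq_square)

lemma gaussian_density_altdef:
  "gaussian_density z = (1 / sqrt (2 * pi)) ^ DIM('a) * exp (- (norm z)\<^sup>2 / 2)"
  for z :: "'a::euclidean_space"
  unfolding gaussian_density_def std_normal_density_def norm_sq_eq_sum_Basis
  by (simp add: prod.distrib exp_sum [symmetric] sum_negf sum_divide_distrib power_divide prod_dividef)

lemma gaussian_density_nonneg [simp]: "0 \<le> gaussian_density z"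
  by (simp add: gaussian_density_altdef)

lemma gaussian_density_measurable [measurable]: "gaussian_density \<in> borel_measurable borel"
  unfolding gaussian_density_def by measurable

lemma space_std_gaussian [simp]: "space std_gaussian = UNIV"
  by (simp add: std_gaussian_def)

lemma sets_std_gaussian [simp, measurable_cong]: "sets std_gaussian = sets borel"
  by (simp add: std_gaussian_def)

lemma nn_integral_std_normal_density: "(\<integral>\<^sup>+x. ennreal (std_normal_density x) \<partial>lborel) = 1"
  using prob_space.emeasure_space_1[OF prob_space_normal_density[of 1 0]]
  by (simp add: emeasure_density)

lemma prob_space_std_gaussian: "prob_space (std_gaussian :: 'a::euclidean_space measure)"
proof
  have "(\<integral>\<^sup>+z. ennreal (gaussian_density (z::'a)) \<partial>lborel)
      = (\<integral>\<^sup>+(z::'a). (\<Prod>b\<in>Basis. ennreal (std_normal_density (z \<bullet> b))) \<partial>lborel)"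
    by (simp add: gaussian_density_def prod_ennreal)
  also have "\<dots> = 1"
    by (subst nn_integral_lborel_prod) (auto simp: nn_integral_std_normal_density)
  finally show "emeasure std_gaussian (space (std_gaussian :: 'a measure)) = 1"
    by (simp add: std_gaussian_eq emeasure_density)
qed

text \<open>Up to a constant the integrand is the product of densities of normal laws with variance \<open>2\<close> in each
coordinate.\<close>

lemma integrable_exp_neg_norm_sq:
  "integrable lborel (\<lambda>z::'a::euclidean_space. exp (- (norm z)\<^sup>2 / 4))"
proof (rule integrableI_nonneg)
  have "(\<integral>\<^sup>+x. ennreal (exp (- x\<^sup>2 / 4)) \<partial>lborel)
      = (\<integral>\<^sup>+x. ennreal (2 * sqrt pi) * ennreal (normal_density 0 (sqrt 2) x) \<partial>lborel)"
    by (intro nn_integral_cong) (simp add: normal_density_def ennreal_mult[symmetric] real_sqrt_mult)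
  also have "\<dots> = ennreal (2 * sqrt pi)"
    using prob_space.emeasure_space_1[OF prob_space_normal_density[of "sqrt 2" 0]]
    by (simp add: emeasure_density nn_integral_cmult)
  finally have 1: "(\<integral>\<^sup>+x. ennreal (exp (- x\<^sup>2 / 4)) \<partial>lborel) = ennreal (2 * sqrt pi)" .
  have "(\<integral>\<^sup>+(z::'a). ennreal (exp (- (norm z)\<^sup>2 / 4)) \<partial>lborel)
      = (\<integral>\<^sup>+(z::'a). (\<Prod>b\<in>Basis. ennreal (exp (- (z \<bullet> b)\<^sup>2 / 4))) \<partial>lborel)"
    by (intro nn_integral_cong)
      (simp add: norm_sq_eq_sum_Basis prod_ennreal exp_sum[symmetric] sum_negf sum_divide_distrib)
  also have "\<dots> = (\<Prod>b\<in>(Basis::'a set). ennreal (2 * sqrt pi))"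
    by (subst nn_integral_lborel_prod) (simp_all add: 1[simplified])
  also have "\<dots> < \<infinity>" by (simp add: ennreal_power less_top[symmetric])
  finally show "(\<integral>\<^sup>+(z::'a). ennreal (exp (- (norm z)\<^sup>2 / 4)) \<partial>lborel) < \<infinity>" .
qed auto

text \<open>The exponent \<open>3\<close> is the sum of \<open>1\<close>, for functions of linear growth, and \<open>2\<close>, for the remainder of
the Gaussian weight in \<open>gaussian_weight_remainder_bound\<close>.\<close>

lemma integrable_exp_norm_std_gaussian:
  "integrable std_gaussian (\<lambda>z::'a::euclidean_space. exp (3 * (norm z + 1)))"
proof -
  define C :: real where "C = (1 / sqrt (2 * pi)) ^ DIM('a)"
  have "integrable lborel (\<lambda>z::'a. gaussian_density z * exp (3 * (norm z + 1)))"
  proof (rule Bochner_Integration.integrable_bound)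
    show "integrable lborel (\<lambda>z::'a. (C * exp 12) * exp (- (norm z)\<^sup>2 / 4))"
      by (intro integrable_mult_right integrable_exp_neg_norm_sq)
    show "AE z::'a in lborel. norm (gaussian_density z * exp (3 * (norm z + 1)))
        \<le> norm ((C * exp 12) * exp (- (norm z)\<^sup>2 / 4))"
    proof (intro AE_I2)
      fix z :: 'a
      \<comment> \<open>that is, \<open>3 * norm z \<le> (norm z)\<^sup>2 / 4 + 9\<close>\<close>
      have "0 \<le> (norm z / 2 - 3)\<^sup>2" by simp
      then have "- (norm z)\<^sup>2 / 2 + 3 * (norm z + 1) \<le> 12 + - (norm z)\<^sup>2 / 4"
        by (simp add: power2_eq_square field_simps)
      then have "exp (- (norm z)\<^sup>2 / 2) * exp (3 * (norm z + 1)) \<le> exp 12 * exp (- (norm z)\<^sup>2 / 4)"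
        by (simp only: exp_add[symmetric] exp_le_cancel_iff)
      then have "C * (exp (- (norm z)\<^sup>2 / 2) * exp (3 * (norm z + 1))) \<le> C * (exp 12 * exp (- (norm z)\<^sup>2 / 4))"
        by (intro mult_left_mono) (simp_all add: C_def)
      then show "norm (gaussian_density z * exp (3 * (norm z + 1)))
        \<le> norm ((C * exp 12) * exp (- (norm z)\<^sup>2 / 4))"
        by (simp add: gaussian_density_altdef C_def abs_mult mult.assoc)
    qed
  qed auto
  then show ?thesis unfolding std_gaussian_eq
    by (subst integrable_real_density) auto
qed

lemma integrable_std_gaussian_if_dominated:
  fixes h :: "'a::euclidean_space \<Rightarrow> 'b::{banach, second_countable_topology}"
  assumes [measurable]: "h \<in> borel_measurable borel"
    and bound: "\<And>z. norm (h z) \<le> C * exp (3 * (norm z + 1))"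
  shows "integrable std_gaussian h"
proof (rule Bochner_Integration.integrable_bound)
  show "integrable std_gaussian (\<lambda>z::'a. C * exp (3 * (norm z + 1)))"
    by (intro integrable_mult_right integrable_exp_norm_std_gaussian)
  show "AE z in std_gaussian. norm (h z) \<le> norm (C * exp (3 * (norm z + 1)))"
    using bound by (intro AE_I2) (metis abs_ge_self order_trans real_norm_def)
qed measurable

section \<open>Gaussian smoothing\<close>

lemma gaussian_density_diff:
  "gaussian_density (w - k) = gaussian_density w * exp (w \<bullet> k - (norm k)\<^sup>2 / 2)"
proof -
  have "- (norm (w - k))\<^sup>2 / 2 = - (norm w)\<^sup>2 / 2 + (w \<bullet> k - (norm k)\<^sup>2 / 2)"
    by (simp add: power2_norm_eq_inner inner_simps inner_commute field_simps)
  then show ?thesis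
    by (simp only: gaussian_density_altdef exp_add mult.assoc)
qed

text \<open>The Cameron-Martin formula for a constant shift: by translation invariance of Lebesgue measure the
increment \<open>u *\<^sub>R k\<close> leaves the argument of \<open>f\<close> and reappears in the density. On the right-hand
side \<open>k\<close> occurs in a smooth weight only, whatever the regularity of \<open>f\<close>.\<close>

lemma gaussian_smoothing_shift:
  fixes f :: "'a::euclidean_space \<Rightarrow> real"
  assumes [measurable]: "f \<in> borel_measurable borel"
  shows "gaussian_smoothing u f (x + u *\<^sub>R k)
    = (\<integral>z. f (x + u *\<^sub>R z) * exp (z \<bullet> k - (norm k)\<^sup>2 / 2) \<partial>std_gaussian)"
proof -
  define h where "h w = gaussian_density (w - k) * f (x + u *\<^sub>R w)" for w
  have [measurable]: "h \<in> borel_measurable borel" unfolding h_def by measurable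
  have "gaussian_smoothing u f (x + u *\<^sub>R k) = (\<integral>z. h (k + z) \<partial>lborel)"
    unfolding gaussian_smoothing_def std_gaussian_eq
    by (subst integral_real_density) (auto simp: h_def algebra_simps)
  also have "\<dots> = (\<integral>w. h w \<partial>distr lborel borel ((+) k))" by (subst integral_distr) auto
  also have "\<dots> = (\<integral>w. h w \<partial>lborel)" by (simp only: lborel_distr_plus)
  also have "\<dots> = (\<integral>z. f (x + u *\<^sub>R z) * exp (z \<bullet> k - (norm k)\<^sup>2 / 2) \<partial>std_gaussian)"
    unfolding std_gaussian_eq
    by (subst integral_real_density)
      (auto simp: h_def gaussian_density_diff mult_ac intro!: Bochner_Integration.integral_cong)
  finally show ?thesis .
qed

lemma exp_linear_remainder_bound:
  fixes a :: real
  shows "\<bar>exp a - 1 - a\<bar> \<le> a\<^sup>2 * exp \<bar>a\<bar>"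
  using Taylor_exp_field[of a 1] by (simp add: power2_eq_square algebra_simps)

text \<open>With \<open>s = norm z + 1\<close> the exponent is at most \<open>norm k * s\<close> in absolute value. Its square,
multiplied by \<open>exp s\<close>, accounts for the Taylor remainder of the exponential, and
\<open>s\<^sup>2 \<le> 2 * exp s\<close> converts the polynomial factor into an exponential one.\<close>

lemma gaussian_weight_remainder_bound:
  fixes z k :: "'a::real_inner"
  assumes k: "norm k \<le> 1"
  shows "\<bar>exp (z \<bullet> k - (norm k)\<^sup>2 / 2) - 1 - z \<bullet> k\<bar> \<le> 3 * (norm k)\<^sup>2 * exp (2 * (norm z + 1))"
proof -
  define s where "s = norm z + 1"
  define a where "a = z \<bullet> k - (norm k)\<^sup>2 / 2"
  have s1: "1 \<le> s" by (simp add: s_def)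
  have kk: "(norm k)\<^sup>2 \<le> norm k" using k by (simp add: power2_eq_square mult_left_le)
  have "\<bar>z \<bullet> k\<bar> \<le> norm z * norm k" by (rule Cauchy_Schwarz_ineq2)
  moreover have "norm k * s = norm z * norm k + norm k" by (simp add: s_def algebra_simps)
  ultimately have a1: "\<bar>a\<bar> \<le> norm k * s" using kk zero_le_power2[of "norm k"]
    unfolding a_def by linarith
  also have "\<dots> \<le> s" using k s1 by (simp add: mult_left_le_one_le)
  finally have a2: "\<bar>a\<bar> \<le> s" .
  have "s\<^sup>2 \<le> 2 * exp s" using exp_lower_Taylor_quadratic[of s] s1 by simp
  then have "s\<^sup>2 * exp s \<le> (2 * exp s) * exp s" by (intro mult_right_mono) auto
  also have "\<dots> = 2 * exp (2 * s)" by (simp add: exp_double power2_eq_square)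
  finally have s2: "s\<^sup>2 * exp s \<le> 2 * exp (2 * s)" .
  have "a\<^sup>2 \<le> (norm k * s)\<^sup>2" using power_mono[OF a1, of 2] by simp
  then have "a\<^sup>2 * exp \<bar>a\<bar> \<le> (norm k * s)\<^sup>2 * exp s"
    using a2 by (intro mult_mono) auto
  also have "\<dots> = (norm k)\<^sup>2 * (s\<^sup>2 * exp s)" by (simp add: power_mult_distrib)
  also have "\<dots> \<le> (norm k)\<^sup>2 * (2 * exp (2 * s))" using s2 by (intro mult_left_mono) auto
  finally have "\<bar>exp a - 1 - a\<bar> \<le> (norm k)\<^sup>2 * (2 * exp (2 * s))"
    using exp_linear_remainder_bound[of a] by linarith
  moreover have "(norm k)\<^sup>2 / 2 \<le> (norm k)\<^sup>2 * exp (2 * s)"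
  proof -
    have "1 \<le> exp (2 * s)" using s1 by simp
    then have "1 / 2 \<le> exp (2 * s)" by linarith
    then have "(norm k)\<^sup>2 * (1 / 2) \<le> (norm k)\<^sup>2 * exp (2 * s)" by (rule mult_left_mono) simp
    then show ?thesis by simp
  qed
  moreover have "exp a - 1 - z \<bullet> k = (exp a - 1 - a) - (norm k)\<^sup>2 / 2" by (simp add: a_def)
  moreover have "0 \<le> (norm k)\<^sup>2 / 2" by simp
  ultimately have "\<bar>exp a - 1 - z \<bullet> k\<bar> \<le> (norm k)\<^sup>2 * (2 * exp (2 * s)) + (norm k)\<^sup>2 * exp (2 * s)"
    by linarith
  then show ?thesis by (simp add: a_def s_def)
qed

context
  fixes f :: "'a::euclidean_space \<Rightarrow> real" and L :: real
  assumes L: "0 \<le> L" and lip: "\<And>x y. \<bar>f y - f x\<bar> \<le> L * norm (y - x)"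
begin

lemma lipschitz_borel_measurable: "f \<in> borel_measurable borel"
proof -
  have "L-lipschitz_on UNIV f" using L lip by (intro lipschitz_onI) (auto simp: dist_norm)
  then show ?thesis by (intro borel_measurable_continuous_onI lipschitz_on_continuous_on)
qed

lemma lipschitz_growth: "\<bar>f (x + u *\<^sub>R z)\<bar> \<le> (\<bar>f x\<bar> + L * \<bar>u\<bar>) * exp (norm z + 1)"
proof -
  have "\<bar>f (x + u *\<^sub>R z)\<bar> \<le> \<bar>f x\<bar> * 1 + L * \<bar>u\<bar> * norm z" using lip[of "x + u *\<^sub>R z" x] by simp
  also have "\<dots> \<le> \<bar>f x\<bar> * exp (norm z + 1) + L * \<bar>u\<bar> * exp (norm z + 1)"
  proof (intro add_mono mult_left_mono)
    show "norm z \<le> exp (norm z + 1)" using exp_ge_add_one_self[of "norm z + 1"] by linarith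
  qed (use L in auto)
  finally show ?thesis by (simp add: algebra_simps)
qed

lemma lipschitz_gaussian_integrable:
  assumes [measurable]: "w \<in> borel_measurable borel"
    and w: "\<And>z. norm (w z :: 'b::{banach, second_countable_topology}) \<le> C * exp (2 * (norm z + 1))"
  shows "integrable std_gaussian (\<lambda>z. f (x + u *\<^sub>R z) *\<^sub>R w z)"
proof (rule integrable_std_gaussian_if_dominated)
  note [measurable] = lipschitz_borel_measurable
  show "(\<lambda>z. f (x + u *\<^sub>R z) *\<^sub>R w z) \<in> borel_measurable borel" by measurable
  fix z
  have "norm (f (x + u *\<^sub>R z) *\<^sub>R w z)
      \<le> ((\<bar>f x\<bar> + L * \<bar>u\<bar>) * exp (norm z + 1)) * (C * exp (2 * (norm z + 1)))"
    unfolding norm_scaleR using L by (intro mult_mono lipschitz_growth w) auto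
  also have "\<dots> = ((\<bar>f x\<bar> + L * \<bar>u\<bar>) * C) * exp (3 * (norm z + 1))"
    by (simp add: mult_exp_exp algebra_simps)
  finally show "norm (f (x + u *\<^sub>R z) *\<^sub>R w z) \<le> ((\<bar>f x\<bar> + L * \<bar>u\<bar>) * C) * exp (3 * (norm z + 1))" .
qed

lemma smoothing_integrable: "integrable std_gaussian (\<lambda>z. f (x + u *\<^sub>R z))"
  using lipschitz_gaussian_integrable[of "\<lambda>_. 1::real" 1 x u] by simp

lemma gaussian_smoothing_lipschitz:
  "\<bar>gaussian_smoothing u f y - gaussian_smoothing u f x\<bar> \<le> L * norm (y - x)"
proof -
  interpret G: prob_space "std_gaussian :: 'a measure" by (rule prob_space_std_gaussian)
  have "gaussian_smoothing u f y - gaussian_smoothing u f x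
      = (\<integral>z. f (y + u *\<^sub>R z) - f (x + u *\<^sub>R z) \<partial>std_gaussian)"
    unfolding gaussian_smoothing_def
    by (rule Bochner_Integration.integral_diff[symmetric]) (rule smoothing_integrable)+
  also have "\<bar>\<dots>\<bar> \<le> (\<integral>z. \<bar>f (y + u *\<^sub>R z) - f (x + u *\<^sub>R z)\<bar> \<partial>std_gaussian)"
    by (rule integral_abs_bound)
  also have "\<dots> \<le> (\<integral>(z::'a). L * norm (y - x) \<partial>std_gaussian)"
    using lip[of "y + u *\<^sub>R z" "x + u *\<^sub>R z" for z]
    by (intro integral_mono integrable_abs Bochner_Integration.integrable_diff smoothing_integrable)
      auto
  finally show ?thesis by (simp add: G.prob_space[simplified])
qed

lemma weakly_convex_gaussian_smoothing:
  assumes wc: "weakly_convex \<rho> f"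
  shows "weakly_convex \<rho> (gaussian_smoothing u f)"
  unfolding weakly_convex_iff
proof (intro allI impI)
  interpret G: prob_space "std_gaussian :: 'a measure" by (rule prob_space_std_gaussian)
  fix x y :: 'a and s :: real assume s: "0 < s" "s < 1"
  have "gaussian_smoothing u f ((1 - s) *\<^sub>R x + s *\<^sub>R y)
      \<le> (\<integral>z. (1 - s) * f (x + u *\<^sub>R z) + s * f (y + u *\<^sub>R z)
          + \<rho> / 2 * s * (1 - s) * (norm (x - y))\<^sup>2 \<partial>std_gaussian)"
    unfolding gaussian_smoothing_def
  proof (rule integral_mono)
    fix z
    have "(1 - s) *\<^sub>R x + s *\<^sub>R y + u *\<^sub>R z
        = (1 - s) *\<^sub>R (x + u *\<^sub>R z) + s *\<^sub>R (y + u *\<^sub>R z)" by (simp add: algebra_simps)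
    then show "f ((1 - s) *\<^sub>R x + s *\<^sub>R y + u *\<^sub>R z) \<le> (1 - s) * f (x + u *\<^sub>R z)
        + s * f (y + u *\<^sub>R z) + \<rho> / 2 * s * (1 - s) * (norm (x - y))\<^sup>2"
      using weakly_convex_inequality[OF wc s, of "x + u *\<^sub>R z" "y + u *\<^sub>R z"] by simp
  qed (intro smoothing_integrable Bochner_Integration.integrable_add integrable_mult_right G.integrable_const)+
  also have "\<dots> = (1 - s) * gaussian_smoothing u f x + s * gaussian_smoothing u f y
      + \<rho> / 2 * s * (1 - s) * (norm (x - y))\<^sup>2"
    unfolding gaussian_smoothing_def
    by (simp add: smoothing_integrable G.prob_space[simplified])
  finally show "gaussian_smoothing u f ((1 - s) *\<^sub>R x + s *\<^sub>R y)
      \<le> (1 - s) * gaussian_smoothing u f x + s * gaussian_smoothing u f y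
      + \<rho> / 2 * s * (1 - s) * (norm (x - y))\<^sup>2" .
qed

text \<open>Inserting the linear expansion of the weight into the shifted integral, the error is an integral of
\<open>f\<close> against the remainder of the weight. The growth of \<open>f\<close> and the remainder bound make it at most a
finite Gaussian moment times \<open>(norm k)\<^sup>2\<close>, where \<open>u *\<^sub>R k\<close> is the increment.\<close>

lemma gaussian_smoothing_gderiv:
  assumes u: "0 < u"
  shows "GDERIV (gaussian_smoothing u f) x
    :> (1 / u) *\<^sub>R (\<integral>z. f (x + u *\<^sub>R z) *\<^sub>R z \<partial>std_gaussian)"
proof (rule gderiv_if_quadratic_remainder[where \<delta> = u])
  define V where "V = (\<integral>z. f (x + u *\<^sub>R z) *\<^sub>R z \<partial>std_gaussian)"
  define A where "A = \<bar>f x\<bar> + L * \<bar>u\<bar>"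
  define J where "J = (\<integral>(z::'a). exp (3 * (norm z + 1)) \<partial>std_gaussian)"
  have A: "0 \<le> A" using L by (simp add: A_def)
  have lin: "norm z \<le> 1 * exp (2 * (norm z + 1))" for z :: 'a
  proof -
    have "norm z \<le> 1 + 2 * (norm z + 1)" by simp
    also have "\<dots> \<le> exp (2 * (norm z + 1))" by (rule exp_ge_add_one_self)
    finally show ?thesis by simp
  qed
  have intV: "integrable std_gaussian (\<lambda>z. f (x + u *\<^sub>R z) *\<^sub>R z)"
    by (rule lipschitz_gaussian_integrable[OF _ lin]) simp
  have main: "\<bar>gaussian_smoothing u f (x + u *\<^sub>R k) - gaussian_smoothing u f x - k \<bullet> V\<bar>
      \<le> 3 * A * J * (norm k)\<^sup>2" if k: "norm k \<le> 1" for k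
  proof -
    define w where "w z = exp (z \<bullet> k - (norm k)\<^sup>2 / 2) - 1 - z \<bullet> k" for z
    have wb: "\<bar>w z\<bar> \<le> 3 * (norm k)\<^sup>2 * exp (2 * (norm z + 1))" for z
      unfolding w_def by (rule gaussian_weight_remainder_bound[OF k])
    have [measurable]: "w \<in> borel_measurable borel" unfolding w_def by measurable
    have int_w: "integrable std_gaussian (\<lambda>z. f (x + u *\<^sub>R z) * w z)"
      using lipschitz_gaussian_integrable[of w "3 * (norm k)\<^sup>2" x u] wb by simp
    have int_k: "integrable std_gaussian (\<lambda>z. f (x + u *\<^sub>R z) * (z \<bullet> k))"
      using integrable_inner_left[OF intV, of k] by simp
    have kV: "k \<bullet> V = (\<integral>z. f (x + u *\<^sub>R z) * (z \<bullet> k) \<partial>std_gaussian)"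
      unfolding V_def using integral_inner_left[OF intV, of k] by (simp add: inner_commute)
    have "gaussian_smoothing u f (x + u *\<^sub>R k)
        = (\<integral>z. f (x + u *\<^sub>R z) * w z + f (x + u *\<^sub>R z) + f (x + u *\<^sub>R z) * (z \<bullet> k) \<partial>std_gaussian)"
      unfolding gaussian_smoothing_shift[OF lipschitz_borel_measurable]
      by (simp add: w_def algebra_simps)
    also have "\<dots> = (\<integral>z. f (x + u *\<^sub>R z) * w z \<partial>std_gaussian) + gaussian_smoothing u f x + k \<bullet> V"
      unfolding kV gaussian_smoothing_def using int_w int_k
      by (simp add: smoothing_integrable)
    finally have "\<bar>gaussian_smoothing u f (x + u *\<^sub>R k) - gaussian_smoothing u f x - k \<bullet> V\<bar>
        = \<bar>\<integral>z. f (x + u *\<^sub>R z) * w z \<partial>std_gaussian\<bar>" by simp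
    also have "\<dots> \<le> (\<integral>z. \<bar>f (x + u *\<^sub>R z) * w z\<bar> \<partial>std_gaussian)" by (rule integral_abs_bound)
    also have "\<dots> \<le> (\<integral>(z::'a). (3 * A * (norm k)\<^sup>2) * exp (3 * (norm z + 1)) \<partial>std_gaussian)"
    proof (rule integral_mono)
      fix z :: 'a
      have "\<bar>f (x + u *\<^sub>R z) * w z\<bar>
          \<le> (A * exp (norm z + 1)) * (3 * (norm k)\<^sup>2 * exp (2 * (norm z + 1)))"
        unfolding abs_mult A_def using L by (intro mult_mono lipschitz_growth wb) auto
      also have "\<dots> = (3 * A * (norm k)\<^sup>2) * exp (3 * (norm z + 1))"
        by (simp add: mult_exp_exp algebra_simps)
      finally show "\<bar>f (x + u *\<^sub>R z) * w z\<bar> \<le> (3 * A * (norm k)\<^sup>2) * exp (3 * (norm z + 1))" .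
    qed (intro integrable_abs int_w integrable_mult_right integrable_exp_norm_std_gaussian)+
    also have "\<dots> = 3 * A * J * (norm k)\<^sup>2" by (simp add: J_def)
    finally show ?thesis .
  qed
  fix h :: 'a assume h: "norm h \<le> u"
  define k where "k = (1 / u) *\<^sub>R h"
  have hk: "u *\<^sub>R k = h" and k: "norm k \<le> 1" and nk: "norm k = norm h / u"
    using u h by (auto simp: k_def)
  have "h \<bullet> ((1 / u) *\<^sub>R V) = k \<bullet> V" by (simp add: k_def)
  then show "\<bar>gaussian_smoothing u f (x + h) - gaussian_smoothing u f x
      - h \<bullet> ((1 / u) *\<^sub>R (\<integral>z. f (x + u *\<^sub>R z) *\<^sub>R z \<partial>std_gaussian))\<bar>
      \<le> (3 * A * J / u\<^sup>2) * (norm h)\<^sup>2"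
    using main[OF k] unfolding hk nk V_def[symmetric] by (simp add: power_divide)
qed (rule u)

end

section \<open>One proximal step along a single path\<close>

text \<open>Convexity of \<open>r\<close> is used on the segment from \<open>p\<close> to \<open>y\<close>, while the other two terms are
differentiated at \<open>p\<close>. With \<open>h = 0\<close> this is the optimality condition of a proximal point of \<open>r\<close>.\<close>

lemma composite_minimizer_subgradient:
  fixes x p :: "'a::real_inner"
  assumes min: "\<And>y. h p + r p + \<mu> / 2 * (norm (p - x))\<^sup>2 \<le> h y + r y + \<mu> / 2 * (norm (y - x))\<^sup>2"
    and r: "convex_on UNIV r" and D: "GDERIV h p :> D"
  shows "r p + (y - p) \<bullet> (\<mu> *\<^sub>R (x - p) - D) \<le> r y"
proof -
  let ?v = "y - p"
  have "((\<lambda>s. (h (p + s *\<^sub>R ?v) - h (p + 0 *\<^sub>R ?v)) / (s - 0)) \<longlongrightarrow> ?v \<bullet> D) (at 0)"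
    using gderiv_line_derivative[OF D] unfolding has_field_derivative_iff by blast
  then have "((\<lambda>s. (h (p + s *\<^sub>R ?v) - h p) / s) \<longlongrightarrow> ?v \<bullet> D) (at_right 0)"
    by (auto intro: filterlim_at_split[THEN iffD1, THEN conjunct2])
  then have lim: "((\<lambda>s. r p - r y - \<mu> * (?v \<bullet> (p - x)) - \<mu> / 2 * s * (norm ?v)\<^sup>2) \<longlongrightarrow>
      r p - r y - \<mu> * (?v \<bullet> (p - x)) - \<mu> / 2 * 0 * (norm ?v)\<^sup>2) (at_right 0)"
    by (intro tendsto_intros)
  have ev: "eventually (\<lambda>s. r p - r y - \<mu> * (?v \<bullet> (p - x)) - \<mu> / 2 * s * (norm ?v)\<^sup>2
      \<le> (h (p + s *\<^sub>R ?v) - h p) / s) (at_right 0)"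
  proof (rule eventually_mono)
    show "eventually (\<lambda>s::real. 0 < s \<and> s < 1) (at_right 0)"
      using eventually_at_right_real[of 0 "1::real"] by (auto elim: eventually_mono)
    fix s :: real assume s: "0 < s \<and> s < 1"
    have eq: "(1 - s) *\<^sub>R p + s *\<^sub>R y = p + s *\<^sub>R ?v" by (simp add: algebra_simps)
    have "r (p + s *\<^sub>R ?v) \<le> (1 - s) * r p + s * r y"
      using convex_onD[OF r, of s p y] s by (simp add: eq)
    moreover have "\<mu> / 2 * (norm (p + s *\<^sub>R ?v - x))\<^sup>2
        = \<mu> / 2 * (norm (p - x))\<^sup>2 + s * (\<mu> * (?v \<bullet> (p - x)) + \<mu> / 2 * s * (norm ?v)\<^sup>2)"
      by (simp add: power2_norm_eq_inner inner_simps inner_commute field_simps)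
    ultimately have "s * (r p - r y - \<mu> * (?v \<bullet> (p - x)) - \<mu> / 2 * s * (norm ?v)\<^sup>2)
        \<le> h (p + s *\<^sub>R ?v) - h p"
      using min[of "p + s *\<^sub>R ?v"] by (simp add: algebra_simps)
    then show "r p - r y - \<mu> * (?v \<bullet> (p - x)) - \<mu> / 2 * s * (norm ?v)\<^sup>2
        \<le> (h (p + s *\<^sub>R ?v) - h p) / s"
      using s by (simp add: le_divide_eq mult.commute)
  qed
  have "r p - r y - \<mu> * (?v \<bullet> (p - x)) - \<mu> / 2 * 0 * (norm ?v)\<^sup>2 \<le> ?v \<bullet> D"
    by (rule tendsto_le[OF _ \<open>((\<lambda>s. (h (p + s *\<^sub>R ?v) - h p) / s) \<longlongrightarrow> ?v \<bullet> D) (at_right 0)\<close> lim ev]) simp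
  then show ?thesis by (simp add: inner_simps algebra_simps)
qed

lemma norm_add_sq_le: "(norm (a + b))\<^sup>2 \<le> 2 * (norm a)\<^sup>2 + 2 * (norm b)\<^sup>2"
  for a b :: "'a::real_inner"
proof -
  have "0 \<le> (norm (a - b))\<^sup>2" by simp
  then show ?thesis by (simp add: power2_norm_eq_inner inner_simps inner_commute)
qed

text \<open>The subgradient inequalities of \<open>r\<close> at \<open>p\<close> and at the new point, each applied to the other point, add
up to an inequality without values of \<open>r\<close>: the squared distance is at most the inner product of the
displacement with the vector on the right.\<close>

lemma prox_step_contraction:
  fixes x g :: "'a::euclidean_space"
  assumes h: "weakly_convex \<rho> h" and r: "convex_on UNIV r"
    and G: "\<And>y. GDERIV h y :> G y"
    and mu: "\<rho> < \<mu>" "0 < \<mu>" and alpha: "0 < \<alpha>"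
  defines "p \<equiv> prox (1 / \<mu>) (\<lambda>y. h y + r y) x"
  shows "norm (prox \<alpha> r (x - \<alpha> *\<^sub>R g) - p)
    \<le> norm ((1 - \<alpha> * \<mu>) *\<^sub>R (x - p) - \<alpha> *\<^sub>R (g - G p))"
proof -
  define q where "q = prox \<alpha> r (x - \<alpha> *\<^sub>R g)"
  define w where "w = (1 - \<alpha> * \<mu>) *\<^sub>R (x - p) - \<alpha> *\<^sub>R (g - G p)"
  have "r p + (q - p) \<bullet> (\<mu> *\<^sub>R (x - p) - G p) \<le> r q"
    using prox_minimizes[OF weakly_convex_add_convex[OF h r] mu, of x]
    by (intro composite_minimizer_subgradient[OF _ r G]) (simp add: p_def)
  moreover have "r q + (p - q) \<bullet> ((1 / \<alpha>) *\<^sub>R (x - \<alpha> *\<^sub>R g - q) - 0) \<le> r p"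
    using prox_minimizes[OF convex_imp_weakly_convex_0[OF r], of "1 / \<alpha>" "x - \<alpha> *\<^sub>R g"] alpha
    by (intro composite_minimizer_subgradient[where h = "\<lambda>_. 0", OF _ r GDERIV_const]) (simp add: q_def)
  ultimately have "(q - p) \<bullet> (\<mu> *\<^sub>R (x - p) - G p) + (p - q) \<bullet> ((1 / \<alpha>) *\<^sub>R (x - \<alpha> *\<^sub>R g - q)) \<le> 0"
    by simp
  then have "\<alpha> * ((q - p) \<bullet> (\<mu> *\<^sub>R (x - p) - G p) + (p - q) \<bullet> ((1 / \<alpha>) *\<^sub>R (x - \<alpha> *\<^sub>R g - q))) \<le> 0"
    using alpha by (simp add: mult_le_0_iff)
  also have "\<alpha> * ((q - p) \<bullet> (\<mu> *\<^sub>R (x - p) - G p) + (p - q) \<bullet> ((1 / \<alpha>) *\<^sub>R (x - \<alpha> *\<^sub>R g - q)))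
      = \<alpha> * ((q - p) \<bullet> (\<mu> *\<^sub>R (x - p) - G p)) + (p - q) \<bullet> (x - \<alpha> *\<^sub>R g - q)"
    using alpha by (simp add: distrib_left)
  also have "\<dots> = (norm (q - p))\<^sup>2 - (q - p) \<bullet> w"
    unfolding w_def by (simp add: power2_norm_eq_inner inner_simps inner_commute algebra_simps)
  finally have "norm (q - p) * norm (q - p) \<le> norm (q - p) * norm w"
    using norm_cauchy_schwarz[of "q - p" w] by (simp add: power2_eq_square)
  then have "norm (q - p) \<le> norm w" by (cases "q = p") auto
  then show ?thesis by (simp add: q_def w_def)
qed

text \<open>The proximal point \<open>p = x - d\<close> enters as a competitor in the envelope of \<open>\<Phi>\<close>. Of the two parts of \<open>g - G p\<close>, the
noise \<open>g - G x\<close> is kept, since its conditional mean is small, and the rest \<open>G x - G p\<close> is handled by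
weak convexity in the inner product with \<open>d\<close> and by the Lipschitz bound in the square.\<close>

lemma moreau_prox_step:
  fixes x g :: "'a::euclidean_space"
  assumes h: "weakly_convex \<rho> h" and r: "convex_on UNIV r" and \<Phi>: "weakly_convex \<rho> \<Phi>"
    and le: "\<And>y. \<Phi> y \<le> h y + r y"
    and G: "\<And>y. GDERIV h y :> G y" and L: "\<And>y. norm (G y) \<le> L"
    and mu: "\<rho> < \<mu>" "0 < \<mu>" and alpha: "0 < \<alpha>" "\<alpha> * \<mu> \<le> 1"
  defines "d \<equiv> x - prox (1 / \<mu>) (\<lambda>y. h y + r y) x"
  shows "moreau \<mu> \<Phi> (prox \<alpha> r (x - \<alpha> *\<^sub>R g))
    \<le> moreau \<mu> (\<lambda>y. h y + r y) x
      + \<mu> / 2 * (((1 - \<alpha> * \<mu>)\<^sup>2 + 2 * \<alpha> * (1 - \<alpha> * \<mu>) * \<rho> - 1) * (norm d)\<^sup>2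
        - 2 * \<alpha> * (1 - \<alpha> * \<mu>) * (d \<bullet> (g - G x))
        + \<alpha>\<^sup>2 * (2 * (norm (g - G x))\<^sup>2 + 8 * L\<^sup>2))"
proof -
  define p where "p = prox (1 / \<mu>) (\<lambda>y. h y + r y) x"
  define q where "q = prox \<alpha> r (x - \<alpha> *\<^sub>R g)"
  define c where "c = 1 - \<alpha> * \<mu>"
  have c: "0 \<le> c" using alpha by (simp add: c_def)
  have d: "d = x - p" by (simp add: d_def p_def)
  have mono: "- \<rho> * (norm d)\<^sup>2 \<le> d \<bullet> (G x - G p)"
    unfolding d by (rule weakly_convex_gradient_monotone[OF h G G])
  have "norm (G x - G p) \<le> 2 * L" using norm_triangle_ineq4[of "G x" "G p"] L[of x] L[of p] by linarith
  then have "(norm (G x - G p))\<^sup>2 \<le> (2 * L)\<^sup>2" by (intro power_mono) auto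
  then have noise: "(norm (g - G p))\<^sup>2 \<le> 2 * (norm (g - G x))\<^sup>2 + 8 * L\<^sup>2"
    using norm_add_sq_le[of "g - G x" "G x - G p"] by (simp add: power_mult_distrib)
  have "moreau \<mu> \<Phi> q \<le> \<Phi> p + \<mu> / 2 * (norm (p - q))\<^sup>2" by (rule moreau_le[OF \<Phi> mu])
  also have "\<dots> \<le> h p + r p + \<mu> / 2 * (norm (c *\<^sub>R d - \<alpha> *\<^sub>R (g - G p)))\<^sup>2"
    using le[of p] prox_step_contraction[OF h r G mu alpha(1), of x g] mu
    by (intro add_mono mult_left_mono power_mono)
      (simp_all add: p_def q_def d_def c_def norm_minus_commute)
  also have "(norm (c *\<^sub>R d - \<alpha> *\<^sub>R (g - G p)))\<^sup>2
      = c\<^sup>2 * (norm d)\<^sup>2 - 2 * \<alpha> * c * (d \<bullet> (g - G x)) - 2 * \<alpha> * c * (d \<bullet> (G x - G p))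
        + \<alpha>\<^sup>2 * (norm (g - G p))\<^sup>2"
    unfolding power2_norm_eq_inner
    by (simp add: inner_simps inner_commute power2_eq_square algebra_simps)
  also have "\<dots> \<le> c\<^sup>2 * (norm d)\<^sup>2 - 2 * \<alpha> * c * (d \<bullet> (g - G x)) - 2 * \<alpha> * c * (- \<rho> * (norm d)\<^sup>2)
        + \<alpha>\<^sup>2 * (2 * (norm (g - G x))\<^sup>2 + 8 * L\<^sup>2)"
    using alpha(1) c by (intro add_mono diff_mono order_refl mult_left_mono mono noise) auto
  finally have "moreau \<mu> \<Phi> q \<le> h p + r p + \<mu> / 2 * (c\<^sup>2 * (norm d)\<^sup>2 - 2 * \<alpha> * c * (d \<bullet> (g - G x))
        - 2 * \<alpha> * c * (- \<rho> * (norm d)\<^sup>2) + \<alpha>\<^sup>2 * (2 * (norm (g - G x))\<^sup>2 + 8 * L\<^sup>2))"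
    using mu by (simp add: mult_left_mono)
  moreover have "moreau \<mu> (\<lambda>y. h y + r y) x = h p + r p + \<mu> / 2 * (norm d)\<^sup>2"
    unfolding moreau_eq_prox[OF weakly_convex_add_convex[OF h r] mu]
    by (simp add: p_def d_def norm_minus_commute)
  ultimately show ?thesis
    unfolding q_def[symmetric] c_def[symmetric] by (simp add: algebra_simps)
qed

text \<open>The first three terms are the coefficient of \<open>(norm d)\<^sup>2\<close> in \<open>moreau_prox_step\<close>, and the last one is
the share of the bias that Young's inequality charges to \<open>(norm d)\<^sup>2\<close>. The restriction
\<open>\<alpha> \<le> (\<mu> - \<rho>) / 2\<close> on the step size is what absorbs that share.\<close>

lemma descent_coefficient_bound:
  fixes \<alpha> \<mu> \<rho> :: real
  assumes "0 < \<alpha>" "\<alpha> * \<mu> \<le> 1" "0 < \<mu>" "0 \<le> \<rho>" "\<rho> < \<mu>" "\<alpha> \<le> (\<mu> - \<rho>) / 2"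
  shows "(1 - \<alpha> * \<mu>)\<^sup>2 + 2 * \<alpha> * (1 - \<alpha> * \<mu>) * \<rho> - 1 + \<alpha>\<^sup>2 * (1 - \<alpha> * \<mu>) \<le> - \<alpha> * (\<mu> - \<rho>)"
proof -
  define c where "c = 1 - \<alpha> * \<mu>"
  have c: "0 \<le> c" "c \<le> 1" using assms by (simp_all add: c_def)
  have "\<alpha> * \<alpha> \<le> \<alpha> * ((\<mu> - \<rho>) / 2)" using assms by (intro mult_left_mono) auto
  then have "c * (c + 2 * \<alpha> * \<rho> + \<alpha>\<^sup>2) \<le> c * (c + 2 * \<alpha> * \<rho> + \<alpha> * ((\<mu> - \<rho>) / 2))"
    using c by (intro mult_left_mono) (auto simp: power2_eq_square)
  also have "\<dots> = 1 - \<alpha> * (\<mu> - \<rho>) - \<alpha> * ((\<mu> - \<rho>) / 2 - \<alpha> * \<mu> * (\<mu> - 3 * \<rho>) / 2)"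
    by (simp add: c_def field_simps)
  also have "\<dots> \<le> 1 - \<alpha> * (\<mu> - \<rho>)"
  proof -
    have "\<alpha> * \<mu> * (\<mu> - 3 * \<rho>) \<le> \<alpha> * \<mu> * (\<mu> - \<rho>)" using assms by (intro mult_left_mono) auto
    also have "\<dots> \<le> 1 * (\<mu> - \<rho>)" using assms by (intro mult_right_mono) auto
    finally have "0 \<le> \<alpha> * ((\<mu> - \<rho>) / 2 - \<alpha> * \<mu> * (\<mu> - 3 * \<rho>) / 2)"
      using assms by (intro mult_nonneg_nonneg) auto
    then show ?thesis by simp
  qed
  finally show ?thesis unfolding c_def[symmetric] by (simp add: power2_eq_square algebra_simps)
qed

section \<open>Conditional expectation and the descent in mean\<close>

text \<open>Directional derivatives are pointwise limits of difference quotients along \<open>1 / (n + 1)\<close>.\<close>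

lemma gderiv_measurable:
  fixes h :: "'a::euclidean_space \<Rightarrow> real"
  assumes [measurable]: "h \<in> borel_measurable borel" and G: "\<And>y. GDERIV h y :> G y"
  shows "G \<in> borel_measurable borel"
proof -
  have "(\<lambda>y. G y \<bullet> b) \<in> borel_measurable borel" for b
  proof (rule borel_measurable_LIMSEQ_real)
    fix y
    have "((\<lambda>s. (h (y + s *\<^sub>R b) - h y) / s) \<longlongrightarrow> b \<bullet> G y) (at 0)"
      using gderiv_line_derivative[OF G[of y], of b] unfolding has_field_derivative_iff by simp
    moreover have "filterlim (\<lambda>n. inverse (real (Suc n))) (at 0) sequentially"
      unfolding filterlim_at using LIMSEQ_inverse_real_of_nat by auto
    ultimately show "(\<lambda>n. (h (y + inverse (real (Suc n)) *\<^sub>R b) - h y) / inverse (real (Suc n)))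
        \<longlonglongrightarrow> G y \<bullet> b"
      unfolding inner_commute[of "G y"] by (rule filterlim_compose)
  qed measurable
  then show ?thesis by (subst borel_measurable_euclidean_space) simp
qed

text \<open>The coordinatewise definition reduces this to the scalar rule for taking out known factors. A
product of norms is the natural integrability condition, as it dominates every coordinate product.\<close>

lemma inner_vec_cond_exp:
  fixes D g :: "'w \<Rightarrow> 'a::euclidean_space"
  assumes F: "sigma_finite_subalgebra M F"
    and D [measurable]: "D \<in> borel_measurable F" and g [measurable]: "g \<in> borel_measurable M"
    and int: "integrable M (\<lambda>\<omega>. norm (D \<omega>) * norm (g \<omega>))"
  shows integrable_inner_vec_cond_exp: "integrable M (\<lambda>\<omega>. D \<omega> \<bullet> vec_cond_exp M F g \<omega>)"
    and integral_inner_vec_cond_exp: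
      "(\<integral>\<omega>. D \<omega> \<bullet> vec_cond_exp M F g \<omega> \<partial>M) = (\<integral>\<omega>. D \<omega> \<bullet> g \<omega> \<partial>M)"
proof -
  interpret sigma_finite_subalgebra M F by (rule F)
  have DM [measurable]: "D \<in> borel_measurable M" using D subalg measurable_from_subalg by blast
  have intb: "integrable M (\<lambda>\<omega>. (D \<omega> \<bullet> b) * (g \<omega> \<bullet> b))" if "b \<in> Basis" for b
  proof (rule Bochner_Integration.integrable_bound[OF int])
    show "AE \<omega> in M. norm ((D \<omega> \<bullet> b) * (g \<omega> \<bullet> b)) \<le> norm (norm (D \<omega>) * norm (g \<omega>))"
      using that by (auto simp: abs_mult intro!: mult_mono Basis_le_norm)
  qed measurable
  have mb: "(\<lambda>\<omega>. D \<omega> \<bullet> b) \<in> borel_measurable F" "(\<lambda>\<omega>. g \<omega> \<bullet> b) \<in> borel_measurable M" for b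
    by measurable
  note ce = real_cond_exp_intg[OF intb mb]
  have eq: "D \<omega> \<bullet> vec_cond_exp M F g \<omega>
      = (\<Sum>b\<in>Basis. (D \<omega> \<bullet> b) * real_cond_exp M F (\<lambda>\<omega>. g \<omega> \<bullet> b) \<omega>)" for \<omega>
    by (simp add: vec_cond_exp_def inner_sum_right mult.commute)
  show "integrable M (\<lambda>\<omega>. D \<omega> \<bullet> vec_cond_exp M F g \<omega>)"
    unfolding eq using ce by auto
  show "(\<integral>\<omega>. D \<omega> \<bullet> vec_cond_exp M F g \<omega> \<partial>M) = (\<integral>\<omega>. D \<omega> \<bullet> g \<omega> \<partial>M)"
    unfolding eq using ce intb by (simp add: euclidean_inner[of "D _" "g _"])
qed

lemma history_measurable:
  assumes "s \<le> t"
  shows "x s \<in> borel_measurable (history M x t)"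
proof -
  have "(\<lambda>\<omega>. \<lambda>s\<in>{..t}. x s \<omega>) \<in> measurable (history M x t) (\<Pi>\<^sub>M s\<in>{..t}. borel)"
    unfolding history_def by (rule measurable_vimage_algebra1) (auto simp: space_PiM)
  from measurable_compose[OF this measurable_component_singleton[of s]] assms
  show ?thesis by simp
qed

lemma subalgebra_history:
  assumes "\<And>s. x s \<in> borel_measurable M"
  shows "subalgebra M (history M x t)"
  unfolding subalgebra_def history_def
proof
  show "sets (vimage_algebra (space M) (\<lambda>\<omega>. \<lambda>s\<in>{..t}. x s \<omega>) (\<Pi>\<^sub>M s\<in>{..t}. borel)) \<subseteq> sets M"
    using assms by (intro sets_image_in_sets measurable_restrict) auto
qed simp

text \<open>One iteration in mean, for an arbitrary \<open>\<sigma>\<close>-algebra \<open>F\<close> for which the current point \<open>X\<close> is measurable. The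
conclusion includes integrability at the next point, so that it can be iterated starting from a
constant. The displacement \<open>D (X \<omega>)\<close> is \<open>F\<close>-measurable, hence its inner product with the estimator
has the same mean as with the conditional expectation of the estimator, where the bias bound
applies.\<close>

lemma expected_moreau_descent:
  fixes h r \<Phi> :: "'a::euclidean_space \<Rightarrow> real" and X g e :: "'w \<Rightarrow> 'a"
  assumes "prob_space M" and F: "subalgebra M F"
    and X: "X \<in> borel_measurable F" and g [measurable]: "g \<in> borel_measurable M"
    and h: "weakly_convex \<rho> h" and r: "convex_on UNIV r" and \<Phi>: "weakly_convex \<rho> \<Phi>"
    and sandwich: "\<And>y. \<Phi> y \<le> h y + r y" "\<And>y. h y + r y \<le> \<Phi> y + c"
    and bdd: "\<And>y. m \<le> \<Phi> y"
    and G: "\<And>y. GDERIV h y :> G y" and L: "\<And>y. norm (G y) \<le> L"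
    and params: "0 \<le> \<rho>" "\<rho> < \<mu>" "0 < \<alpha>" "\<alpha> * \<mu> \<le> 1" "\<alpha> \<le> (\<mu> - \<rho>) / 2" "0 \<le> E" "0 \<le> \<sigma>"
    and bias: "AE \<omega> in M. norm (e \<omega>) \<le> E \<and> vec_cond_exp M F g \<omega> = G (X \<omega>) + \<alpha> *\<^sub>R e \<omega>"
    and var: "AE \<omega> in M. nn_cond_exp M F (\<lambda>\<omega>'. ennreal ((norm (g \<omega>' - G (X \<omega>')))\<^sup>2)) \<omega> \<le> ennreal \<sigma>"
    and int: "integrable M (\<lambda>\<omega>. moreau \<mu> \<Phi> (X \<omega>))"
  shows integrable_moreau_prox_step:
      "integrable M (\<lambda>\<omega>. moreau \<mu> \<Phi> (prox \<alpha> r (X \<omega> - \<alpha> *\<^sub>R g \<omega>)))" (is ?int')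
    and integrable_moreau_gradient:
      "integrable M (\<lambda>\<omega>. (norm (gradient (moreau \<mu> (\<lambda>y. h y + r y)) (X \<omega>)))\<^sup>2)" (is ?intg)
    and integral_moreau_prox_step_le:
      "(\<integral>\<omega>. moreau \<mu> \<Phi> (prox \<alpha> r (X \<omega> - \<alpha> *\<^sub>R g \<omega>)) \<partial>M)
        \<le> (\<integral>\<omega>. moreau \<mu> \<Phi> (X \<omega>) \<partial>M) + c + (E\<^sup>2 + 2 * \<sigma> + 8 * L\<^sup>2) * \<mu> / 2 * \<alpha>\<^sup>2
          - \<alpha> * (\<mu> - \<rho>) / (2 * \<mu>)
            * (\<integral>\<omega>. (norm (gradient (moreau \<mu> (\<lambda>y. h y + r y)) (X \<omega>)))\<^sup>2 \<partial>M)" (is ?le)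
proof -
  interpret prob_space M by fact
  interpret finite_measure_subalgebra M F by unfold_locales (rule F)
  have mu: "\<rho> < \<mu>" "0 < \<mu>" using params by auto
  define \<Psi> where "\<Psi> = (\<lambda>y. h y + r y)"
  have \<Psi>: "weakly_convex \<rho> \<Psi>" unfolding \<Psi>_def by (rule weakly_convex_add_convex[OF h r])
  define D where "D x = x - prox (1 / \<mu>) \<Psi> x" for x
  define N where "N \<omega> = g \<omega> - G (X \<omega>)" for \<omega>
  have grad: "gradient (moreau \<mu> \<Psi>) x = \<mu> *\<^sub>R D x" for x
    unfolding D_def by (rule gradient_moreau[OF \<Psi> mu])
  have L0: "0 \<le> L" using L[of undefined] norm_ge_zero order_trans by blast

  have [measurable]: "h \<in> borel_measurable borel" "prox (1 / \<mu>) \<Psi> \<in> borel_measurable borel"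
      "prox \<alpha> r \<in> borel_measurable borel"
    using weakly_convex_continuous[OF h] prox_continuous[OF \<Psi> mu]
      prox_continuous[OF convex_imp_weakly_convex_0[OF r], of "1 / \<alpha>"] params
    by (auto intro: borel_measurable_continuous_onI)
  have [measurable]: "G \<in> borel_measurable borel" by (rule gderiv_measurable[OF _ G]) measurable
  have D_meas [measurable]: "D \<in> borel_measurable borel" unfolding D_def by measurable
  have moreau_meas [measurable]: "moreau \<mu> k \<in> borel_measurable borel" if "weakly_convex \<rho> k"
    for k :: "'a \<Rightarrow> real"
    using gderiv_moreau[OF that mu] unfolding gderiv_def
    by (intro borel_measurable_continuous_onI continuous_at_imp_continuous_on)
      (blast intro: has_derivative_continuous)
  note [measurable] = moreau_meas[OF \<Phi>] moreau_meas[OF \<Psi>]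
  have XM [measurable]: "X \<in> borel_measurable M" by (rule measurable_from_subalg[OF F X])
  have N_meas [measurable]: "N \<in> borel_measurable M" unfolding N_def by measurable
  have DX_meas: "(\<lambda>\<omega>. D (X \<omega>)) \<in> borel_measurable F" using X by measurable

  \<comment> \<open>The lower bound \<open>m\<close> of the objective makes the displacement subordinate to the envelope.\<close>
  have lower: "m \<le> moreau \<mu> \<Phi> x" for x
    unfolding moreau_eq_prox[OF \<Phi> mu] using bdd mu by (simp add: add_increasing2)
  have env: "moreau \<mu> \<Psi> x = \<Psi> (prox (1 / \<mu>) \<Psi> x) + \<mu> / 2 * (norm (D x))\<^sup>2" for x
    unfolding moreau_eq_prox[OF \<Psi> mu] D_def by (simp add: norm_minus_commute)
  have env_lower: "m + \<mu> / 2 * (norm (D x))\<^sup>2 \<le> moreau \<mu> \<Psi> x" for x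
    unfolding env using order_trans[OF bdd sandwich(1)] by (simp add: \<Psi>_def)
  have env_upper: "moreau \<mu> \<Psi> x \<le> moreau \<mu> \<Phi> x + c" for x
  proof -
    let ?p = "prox (1 / \<mu>) \<Phi> x"
    have "moreau \<mu> \<Psi> x \<le> \<Psi> ?p + \<mu> / 2 * (norm (?p - x))\<^sup>2" by (rule moreau_le[OF \<Psi> mu])
    then show ?thesis using sandwich(2)[of ?p] unfolding moreau_eq_prox[OF \<Phi> mu, of x]
      by (simp add: \<Psi>_def)
  qed

  have intE: "integrable M (\<lambda>\<omega>. moreau \<mu> \<Psi> (X \<omega>))"
  proof (rule Bochner_Integration.integrable_bound)
    show "integrable M (\<lambda>\<omega>. \<bar>moreau \<mu> \<Phi> (X \<omega>)\<bar> + (\<bar>c\<bar> + \<bar>m\<bar>))" using int by auto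
    show "AE \<omega> in M. norm (moreau \<mu> \<Psi> (X \<omega>)) \<le> norm (\<bar>moreau \<mu> \<Phi> (X \<omega>)\<bar> + (\<bar>c\<bar> + \<bar>m\<bar>))"
    proof (intro AE_I2)
      fix \<omega>
      have "0 \<le> \<mu> / 2 * (norm (D (X \<omega>)))\<^sup>2" using mu by simp
      then show "norm (moreau \<mu> \<Psi> (X \<omega>)) \<le> norm (\<bar>moreau \<mu> \<Phi> (X \<omega>)\<bar> + (\<bar>c\<bar> + \<bar>m\<bar>))"
        using env_lower[of "X \<omega>"] env_upper[of "X \<omega>"] by simp
    qed
  qed measurable
  have intD: "integrable M (\<lambda>\<omega>. (norm (D (X \<omega>)))\<^sup>2)"
  proof (rule Bochner_Integration.integrable_bound)
    show "integrable M (\<lambda>\<omega>. (moreau \<mu> \<Psi> (X \<omega>) - m) * (2 / \<mu>))" using intE by auto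
    show "AE \<omega> in M. norm ((norm (D (X \<omega>)))\<^sup>2) \<le> norm ((moreau \<mu> \<Psi> (X \<omega>) - m) * (2 / \<mu>))"
    proof (intro AE_I2)
      fix \<omega>
      have "(norm (D (X \<omega>)))\<^sup>2 \<le> (moreau \<mu> \<Psi> (X \<omega>) - m) * (2 / \<mu>)"
        using env_lower[of "X \<omega>"] mu by (simp add: field_simps)
      then show "norm ((norm (D (X \<omega>)))\<^sup>2) \<le> norm ((moreau \<mu> \<Psi> (X \<omega>) - m) * (2 / \<mu>))"
        unfolding real_norm_def abs_power2 by (rule order_trans[OF _ abs_ge_self])
    qed
  qed measurable
  have nnN: "(\<integral>\<^sup>+\<omega>. ennreal ((norm (N \<omega>))\<^sup>2) \<partial>M) \<le> ennreal \<sigma>"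
  proof -
    have "(\<integral>\<^sup>+\<omega>. ennreal ((norm (N \<omega>))\<^sup>2) \<partial>M)
        = (\<integral>\<^sup>+\<omega>. nn_cond_exp M F (\<lambda>\<omega>'. ennreal ((norm (N \<omega>'))\<^sup>2)) \<omega> \<partial>M)"
      using nn_cond_exp_intg[of "\<lambda>_. 1" "\<lambda>\<omega>'. ennreal ((norm (N \<omega>'))\<^sup>2)"] by simp
    also have "\<dots> \<le> (\<integral>\<^sup>+\<omega>. ennreal \<sigma> \<partial>M)"
      using var by (intro nn_integral_mono_AE) (simp add: N_def)
    finally show ?thesis by (simp add: emeasure_space_1)
  qed
  have intN: "integrable M (\<lambda>\<omega>. (norm (N \<omega>))\<^sup>2)"
    by (rule integrableI_nonneg) (use nnN in \<open>auto simp: order_le_less_trans\<close>)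
  have EN: "(\<integral>\<omega>. (norm (N \<omega>))\<^sup>2 \<partial>M) \<le> \<sigma>"
    using nnN nn_integral_eq_integral[OF intN] params(7) by simp

  \<comment> \<open>Every vector dominated by \<open>norm (N \<omega>) + L\<close> is square integrable, which covers \<open>g\<close>, \<open>N\<close> and \<open>G (X \<omega>)\<close>.\<close>
  have young: "a * b \<le> a\<^sup>2 + b\<^sup>2" if "0 \<le> a" "0 \<le> b" for a b :: real
    using sum_squares_bound[of a b] mult_nonneg_nonneg[OF that] by simp
  have int_prod: "integrable M (\<lambda>\<omega>. norm (D (X \<omega>)) * norm (k \<omega>))"
    if [measurable]: "k \<in> borel_measurable M" and k: "\<And>\<omega>. norm (k \<omega>) \<le> norm (N \<omega>) + L"
    for k :: "'w \<Rightarrow> 'a"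
  proof (rule Bochner_Integration.integrable_bound)
    show "integrable M (\<lambda>\<omega>. (norm (D (X \<omega>)))\<^sup>2 + (2 * (norm (N \<omega>))\<^sup>2 + 2 * L\<^sup>2))"
      using intD intN by auto
    show "AE \<omega> in M. norm (norm (D (X \<omega>)) * norm (k \<omega>))
        \<le> norm ((norm (D (X \<omega>)))\<^sup>2 + (2 * (norm (N \<omega>))\<^sup>2 + 2 * L\<^sup>2))"
    proof (intro AE_I2)
      fix \<omega>
      have "(norm (k \<omega>))\<^sup>2 \<le> (norm (N \<omega>) + L)\<^sup>2" using k by (intro power_mono) auto
      also have "\<dots> \<le> 2 * (norm (N \<omega>))\<^sup>2 + 2 * L\<^sup>2" using norm_add_sq_le[of "norm (N \<omega>)" L] by simp
      finally show "norm (norm (D (X \<omega>)) * norm (k \<omega>))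
        \<le> norm ((norm (D (X \<omega>)))\<^sup>2 + (2 * (norm (N \<omega>))\<^sup>2 + 2 * L\<^sup>2))"
        using young[of "norm (D (X \<omega>))" "norm (k \<omega>)"] by simp
    qed
  qed measurable
  have int_inner: "integrable M (\<lambda>\<omega>. D (X \<omega>) \<bullet> k \<omega>)"
    if [measurable]: "k \<in> borel_measurable M" and k: "\<And>\<omega>. norm (k \<omega>) \<le> norm (N \<omega>) + L"
    for k :: "'w \<Rightarrow> 'a"
    by (rule Bochner_Integration.integrable_bound[OF int_prod[OF that]])
      (auto intro!: AE_I2 simp: abs_mult Cauchy_Schwarz_ineq2)
  have g_le: "norm (g \<omega>) \<le> norm (N \<omega>) + L" for \<omega>
    using norm_triangle_ineq[of "N \<omega>" "G (X \<omega>)"] L[of "X \<omega>"] by (simp add: N_def)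
  have G_le: "norm (G (X \<omega>)) \<le> norm (N \<omega>) + L" for \<omega> using L[of "X \<omega>"] by (simp add: add_increasing)
  have N_le: "norm (N \<omega>) \<le> norm (N \<omega>) + L" for \<omega> using L0 by simp
  note int_g = int_inner[OF g g_le] and int_N = int_inner[OF N_meas N_le]
  have int_G: "integrable M (\<lambda>\<omega>. D (X \<omega>) \<bullet> G (X \<omega>))" by (rule int_inner[OF _ G_le]) measurable
  note vce = inner_vec_cond_exp[OF sigma_finite_subalgebra_axioms DX_meas g int_prod[OF g g_le]]
  have cross: "- \<alpha> / 2 * ((\<integral>\<omega>. (norm (D (X \<omega>)))\<^sup>2 \<partial>M) + E\<^sup>2) \<le> (\<integral>\<omega>. D (X \<omega>) \<bullet> N \<omega> \<partial>M)"
  proof -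
    have "- \<alpha> / 2 * ((\<integral>\<omega>. (norm (D (X \<omega>)))\<^sup>2 \<partial>M) + E\<^sup>2)
        = (\<integral>\<omega>. - \<alpha> / 2 * ((norm (D (X \<omega>)))\<^sup>2 + E\<^sup>2) \<partial>M)"
      using intD by (simp add: prob_space)
    also have "\<dots> \<le> (\<integral>\<omega>. D (X \<omega>) \<bullet> vec_cond_exp M F g \<omega> - D (X \<omega>) \<bullet> G (X \<omega>) \<partial>M)"
    proof (rule integral_mono_AE)
      show "AE \<omega> in M. - \<alpha> / 2 * ((norm (D (X \<omega>)))\<^sup>2 + E\<^sup>2)
          \<le> D (X \<omega>) \<bullet> vec_cond_exp M F g \<omega> - D (X \<omega>) \<bullet> G (X \<omega>)"
        using bias
      proof eventually_elim
        fix \<omega> assume b: "norm (e \<omega>) \<le> E \<and> vec_cond_exp M F g \<omega> = G (X \<omega>) + \<alpha> *\<^sub>R e \<omega>"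
        let ?d = "D (X \<omega>)"
        have "\<bar>?d \<bullet> e \<omega>\<bar> \<le> norm ?d * norm (e \<omega>)" by (rule Cauchy_Schwarz_ineq2)
        also have "\<dots> \<le> norm ?d * E" using b by (intro mult_left_mono) auto
        also have "\<dots> \<le> ((norm ?d)\<^sup>2 + E\<^sup>2) / 2" using sum_squares_bound[of "norm ?d" E] by simp
        finally have "- (((norm ?d)\<^sup>2 + E\<^sup>2) / 2) \<le> ?d \<bullet> e \<omega>" by linarith
        then have "\<alpha> * (- (((norm ?d)\<^sup>2 + E\<^sup>2) / 2)) \<le> \<alpha> * (?d \<bullet> e \<omega>)"
          using params by (intro mult_left_mono) auto
        then show "- \<alpha> / 2 * ((norm ?d)\<^sup>2 + E\<^sup>2) \<le> ?d \<bullet> vec_cond_exp M F g \<omega> - ?d \<bullet> G (X \<omega>)"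
          using b by (simp add: inner_simps field_simps)
      qed
    qed (use intD vce(1) int_G in auto)
    also have "\<dots> = (\<integral>\<omega>. D (X \<omega>) \<bullet> g \<omega> - D (X \<omega>) \<bullet> G (X \<omega>) \<partial>M)"
      using vce int_g int_G by simp
    also have "\<dots> = (\<integral>\<omega>. D (X \<omega>) \<bullet> N \<omega> \<partial>M)" by (simp add: N_def inner_diff_right)
    finally show ?thesis .
  qed

  \<comment> \<open>The pathwise bound \<open>R\<close> is integrable, and together with \<open>m\<close> it encloses the next envelope value.\<close>
  define \<gamma> where "\<gamma> = (1 - \<alpha> * \<mu>)\<^sup>2 + 2 * \<alpha> * (1 - \<alpha> * \<mu>) * \<rho> - 1"
  define R where "R \<omega> = moreau \<mu> \<Psi> (X \<omega>) + \<mu> / 2 * (\<gamma> * (norm (D (X \<omega>)))\<^sup>2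
      - 2 * \<alpha> * (1 - \<alpha> * \<mu>) * (D (X \<omega>) \<bullet> N \<omega>) + \<alpha>\<^sup>2 * (2 * (norm (N \<omega>))\<^sup>2 + 8 * L\<^sup>2))" for \<omega>
  have intR: "integrable M R" unfolding R_def using intE intD int_N intN by auto
  let ?X' = "\<lambda>\<omega>. prox \<alpha> r (X \<omega> - \<alpha> *\<^sub>R g \<omega>)"
  have step: "moreau \<mu> \<Phi> (?X' \<omega>) \<le> R \<omega>" for \<omega>
    unfolding R_def \<gamma>_def D_def N_def \<Psi>_def
    by (rule moreau_prox_step[OF h r \<Phi> sandwich(1) G L mu params(3,4)])
  have int': ?int'
  proof (rule Bochner_Integration.integrable_bound)
    show "integrable M (\<lambda>\<omega>. \<bar>R \<omega>\<bar> + \<bar>m\<bar>)" using intR by auto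
    show "AE \<omega> in M. norm (moreau \<mu> \<Phi> (?X' \<omega>)) \<le> norm (\<bar>R \<omega>\<bar> + \<bar>m\<bar>)"
    proof (intro AE_I2)
      fix \<omega>
      show "norm (moreau \<mu> \<Phi> (?X' \<omega>)) \<le> norm (\<bar>R \<omega>\<bar> + \<bar>m\<bar>)"
        using step[of \<omega>] lower[of "?X' \<omega>"] by simp
    qed
  qed measurable
  then show ?int' .
  have norm_grad: "(norm (gradient (moreau \<mu> (\<lambda>y. h y + r y)) x))\<^sup>2 = \<mu>\<^sup>2 * (norm (D x))\<^sup>2" for x
    using grad[of x] by (simp add: \<Psi>_def power_mult_distrib)
  show ?intg unfolding norm_grad using intD by auto
  define d2 where "d2 = (\<integral>\<omega>. (norm (D (X \<omega>)))\<^sup>2 \<partial>M)"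
  have d2: "0 \<le> d2" by (simp add: d2_def)
  have "(\<integral>\<omega>. moreau \<mu> \<Phi> (?X' \<omega>) \<partial>M) \<le> (\<integral>\<omega>. R \<omega> \<partial>M)"
    using int' intR step by (rule integral_mono)
  also have "\<dots> = (\<integral>\<omega>. moreau \<mu> \<Psi> (X \<omega>) \<partial>M) + \<mu> / 2 * (\<gamma> * d2
      - 2 * \<alpha> * (1 - \<alpha> * \<mu>) * (\<integral>\<omega>. D (X \<omega>) \<bullet> N \<omega> \<partial>M)
      + \<alpha>\<^sup>2 * (2 * (\<integral>\<omega>. (norm (N \<omega>))\<^sup>2 \<partial>M) + 8 * L\<^sup>2))"
    unfolding R_def d2_def using intE intD int_N intN by (simp add: prob_space)
  also have "\<dots> \<le> ((\<integral>\<omega>. moreau \<mu> \<Phi> (X \<omega>) \<partial>M) + c) + \<mu> / 2 * (\<gamma> * d2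
      - 2 * \<alpha> * (1 - \<alpha> * \<mu>) * (- \<alpha> / 2 * (d2 + E\<^sup>2)) + \<alpha>\<^sup>2 * (2 * \<sigma> + 8 * L\<^sup>2))"
  proof (rule add_mono)
    have "(\<integral>\<omega>. moreau \<mu> \<Psi> (X \<omega>) \<partial>M) \<le> (\<integral>\<omega>. moreau \<mu> \<Phi> (X \<omega>) + c \<partial>M)"
      using intE int env_upper by (intro integral_mono) auto
    then show "(\<integral>\<omega>. moreau \<mu> \<Psi> (X \<omega>) \<partial>M) \<le> (\<integral>\<omega>. moreau \<mu> \<Phi> (X \<omega>) \<partial>M) + c"
      using int by (simp add: prob_space)
    have "2 * \<alpha> * (1 - \<alpha> * \<mu>) * (- \<alpha> / 2 * (d2 + E\<^sup>2))
        \<le> 2 * \<alpha> * (1 - \<alpha> * \<mu>) * (\<integral>\<omega>. D (X \<omega>) \<bullet> N \<omega> \<partial>M)"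
      using params cross unfolding d2_def by (intro mult_left_mono) auto
    moreover have "\<alpha>\<^sup>2 * (2 * (\<integral>\<omega>. (norm (N \<omega>))\<^sup>2 \<partial>M) + 8 * L\<^sup>2) \<le> \<alpha>\<^sup>2 * (2 * \<sigma> + 8 * L\<^sup>2)"
      using EN by (intro mult_left_mono) auto
    ultimately show "\<mu> / 2 * (\<gamma> * d2 - 2 * \<alpha> * (1 - \<alpha> * \<mu>) * (\<integral>\<omega>. D (X \<omega>) \<bullet> N \<omega> \<partial>M)
          + \<alpha>\<^sup>2 * (2 * (\<integral>\<omega>. (norm (N \<omega>))\<^sup>2 \<partial>M) + 8 * L\<^sup>2))
        \<le> \<mu> / 2 * (\<gamma> * d2 - 2 * \<alpha> * (1 - \<alpha> * \<mu>) * (- \<alpha> / 2 * (d2 + E\<^sup>2)) + \<alpha>\<^sup>2 * (2 * \<sigma> + 8 * L\<^sup>2))"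
      using mu by (intro mult_left_mono) auto
  qed
  also have "\<dots> = (\<integral>\<omega>. moreau \<mu> \<Phi> (X \<omega>) \<partial>M) + c
      + \<mu> / 2 * ((\<gamma> + \<alpha>\<^sup>2 * (1 - \<alpha> * \<mu>)) * d2 + \<alpha>\<^sup>2 * ((1 - \<alpha> * \<mu>) * E\<^sup>2 + 2 * \<sigma> + 8 * L\<^sup>2))"
    by (simp add: power2_eq_square field_simps)
  also have "\<dots> \<le> (\<integral>\<omega>. moreau \<mu> \<Phi> (X \<omega>) \<partial>M) + c
      + \<mu> / 2 * ((- \<alpha> * (\<mu> - \<rho>)) * d2 + \<alpha>\<^sup>2 * (1 * E\<^sup>2 + 2 * \<sigma> + 8 * L\<^sup>2))"
  proof (intro add_mono order_refl mult_left_mono mult_right_mono)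
    show "\<gamma> + \<alpha>\<^sup>2 * (1 - \<alpha> * \<mu>) \<le> - \<alpha> * (\<mu> - \<rho>)"
      unfolding \<gamma>_def using params mu by (intro descent_coefficient_bound)
    show "1 - \<alpha> * \<mu> \<le> 1" using params mu by simp
  qed (use mu params d2 in auto)
  also have "\<dots> = (\<integral>\<omega>. moreau \<mu> \<Phi> (X \<omega>) \<partial>M) + c + (E\<^sup>2 + 2 * \<sigma> + 8 * L\<^sup>2) * \<mu> / 2 * \<alpha>\<^sup>2
      - \<alpha> * (\<mu> - \<rho>) / (2 * \<mu>) * (\<mu>\<^sup>2 * d2)"
    using mu by (simp add: power2_eq_square field_simps)
  also have "\<mu>\<^sup>2 * d2 = (\<integral>\<omega>. (norm (gradient (moreau \<mu> (\<lambda>y. h y + r y)) (X \<omega>)))\<^sup>2 \<partial>M)"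
    unfolding norm_grad d2_def using intD by simp
  finally show ?le .
qed

section \<open>The iterates and the sampled index\<close>

text \<open>The measure space \<open>N\<close> is left open because the lemma serves twice: for the underlying probability
space and for the \<open>\<sigma>\<close>-algebra generated by the samples, of which the random index is independent.\<close>

lemma prox_iterates_measurable:
  fixes x g Z1 Z2 :: "nat \<Rightarrow> 'w \<Rightarrow> 'a::euclidean_space" and F :: "'a \<Rightarrow> 's \<Rightarrow> real"
  assumes F: "(\<lambda>(y, s). F y s) \<in> borel_measurable (borel \<Otimes>\<^sub>M P)"
    and r: "convex_on UNIV r" and \<alpha>: "\<And>t. 0 < \<alpha> t"
    and triple: "\<And>t. (\<lambda>\<omega>. (\<xi> t \<omega>, Z1 t \<omega>, Z2 t \<omega>)) \<in> measurable N (P \<Otimes>\<^sub>M borel \<Otimes>\<^sub>M borel)"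
    and g: "\<And>t \<omega>. g t \<omega> =
           ((F (x t \<omega> + u1 t *\<^sub>R Z1 t \<omega> + u2 t *\<^sub>R Z2 t \<omega>) (\<xi> t \<omega>)
             - F (x t \<omega> + u1 t *\<^sub>R Z1 t \<omega>) (\<xi> t \<omega>)) / u2 t) *\<^sub>R Z2 t \<omega>"
    and x0: "\<And>\<omega>. x 0 \<omega> = x0"
    and step: "\<And>t \<omega>. x (Suc t) \<omega> = prox (\<alpha> t) r (x t \<omega> - \<alpha> t *\<^sub>R g t \<omega>)"
  shows "x t \<in> borel_measurable N" and "g t \<in> borel_measurable N"
proof -
  have [measurable]: "\<xi> t \<in> measurable N P" "Z1 t \<in> borel_measurable N" "Z2 t \<in> borel_measurable N" for t
    using measurable_compose[OF triple measurable_fst] measurable_compose[OF triple measurable_snd]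
      measurable_compose[OF measurable_compose[OF triple measurable_snd] measurable_fst]
      measurable_compose[OF measurable_compose[OF triple measurable_snd] measurable_snd]
    by simp_all
  have F': "(\<lambda>\<omega>. F (y \<omega>) (\<xi> t \<omega>)) \<in> borel_measurable N" if [measurable]: "y \<in> borel_measurable N" for y t
  proof -
    have "(\<lambda>\<omega>. (y \<omega>, \<xi> t \<omega>)) \<in> measurable N (borel \<Otimes>\<^sub>M P)" by measurable
    from measurable_compose[OF this F] show ?thesis by simp
  qed
  have g_meas: "g t \<in> borel_measurable N" if [measurable]: "x t \<in> borel_measurable N" for t
  proof -
    have [measurable]: "(\<lambda>\<omega>. F (x t \<omega> + u1 t *\<^sub>R Z1 t \<omega> + u2 t *\<^sub>R Z2 t \<omega>) (\<xi> t \<omega>)) \<in> borel_measurable N"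
        "(\<lambda>\<omega>. F (x t \<omega> + u1 t *\<^sub>R Z1 t \<omega>) (\<xi> t \<omega>)) \<in> borel_measurable N"
      by (rule F', measurable)+
    show ?thesis unfolding g[abs_def] by measurable
  qed
  have prox_meas [measurable]: "prox (\<alpha> t) r \<in> borel_measurable borel" for t
    using prox_continuous[OF convex_imp_weakly_convex_0[OF r], of "1 / \<alpha> t"] \<alpha>[of t]
    by (auto intro: borel_measurable_continuous_onI)
  show x_meas: "x t \<in> borel_measurable N" for t
  proof (induction t)
    case 0
    have "x 0 = (\<lambda>_. x0)" using x0 by blast
    then show ?case by simp
  next
    case (Suc t)
    note [measurable] = Suc g_meas[OF Suc]
    have "x (Suc t) = (\<lambda>\<omega>. prox (\<alpha> t) r (x t \<omega> - \<alpha> t *\<^sub>R g t \<omega>))" using step by blast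
    then show ?case by simp
  qed
  show "g t \<in> borel_measurable N" by (rule g_meas[OF x_meas])
qed

text \<open>The value at the random index is the finite sum of the \<open>H t\<close> cut off to the events \<open>ts = t\<close>; each
summand is a product of independent factors. Indices above \<open>T\<close> have probability zero because the
weights \<open>p t\<close> already exhaust the total mass.\<close>

lemma integral_at_random_index:
  fixes H :: "nat \<Rightarrow> 'w \<Rightarrow> real"
  assumes "prob_space M" and V: "subalgebra M V"
    and H: "\<And>t. H t \<in> borel_measurable V" "\<And>t. integrable M (H t)"
    and ts: "ts \<in> measurable M (count_space UNIV)"
    and p: "\<And>t. t \<le> T \<Longrightarrow> measure M {\<omega> \<in> space M. ts \<omega> = t} = p t" "(\<Sum>t\<le>T. p t) = 1"
    and indep: "prob_space.indep_set M
          (sets (vimage_algebra (space M) ts (count_space UNIV))) (sets V)"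
  shows "(\<integral>\<omega>. H (ts \<omega>) \<omega> \<partial>M) = (\<Sum>t\<le>T. p t * (\<integral>\<omega>. H t \<omega> \<partial>M))"
proof -
  interpret prob_space M by fact
  note [measurable] = ts
  have spV: "space V = space M" and subV: "sets V \<subseteq> sets M" using V by (auto simp: subalgebra_def)
  have HM [measurable]: "H t \<in> borel_measurable M" for t using H(2) by auto
  define I where "I t \<omega> = (indicator {\<omega> \<in> space M. ts \<omega> = t} \<omega> :: real)" for t \<omega>
  have IM [measurable]: "I t \<in> borel_measurable M" for t unfolding I_def by measurable
  have intI: "integrable M (I t)" for t
    by (rule integrable_const_bound[where B = 1]) (auto simp: I_def)
  have prod: "integrable M (\<lambda>\<omega>. I t \<omega> * H t \<omega>) \<and>
      (\<integral>\<omega>. I t \<omega> * H t \<omega> \<partial>M) = measure M {\<omega> \<in> space M. ts \<omega> = t} * (\<integral>\<omega>. H t \<omega> \<partial>M)" for t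
  proof -
    let ?N = "vimage_algebra (space M) ts (count_space UNIV)"
    have IN: "I t \<in> borel_measurable ?N"
    proof -
      have [measurable]: "ts \<in> measurable ?N (count_space UNIV)"
        by (rule measurable_vimage_algebra1) simp
      have "{\<omega> \<in> space ?N. ts \<omega> = t} \<in> sets ?N" by measurable
      then show ?thesis unfolding I_def by (intro borel_measurable_indicator) simp
    qed
    have gen: "sigma_sets (space M) {X -` A \<inter> space M | A. A \<in> sets borel} \<subseteq> sets N"
      if X: "X \<in> borel_measurable N" and N: "space N = space M" for X :: "'w \<Rightarrow> real" and N
      unfolding N[symmetric] using X by (intro sets.sigma_sets_subset) (auto intro: measurable_sets)
    have "indep_var borel (I t) borel (H t)"
      unfolding indep_var_eq
    proof (intro conjI)
      show "indep_set (sigma_sets (space M) {I t -` A \<inter> space M | A. A \<in> sets borel})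
          (sigma_sets (space M) {H t -` A \<inter> space M | A. A \<in> sets borel})"
        (is "indep_set ?A ?B")
      proof -
        have "?A \<subseteq> sets ?N" "?B \<subseteq> sets V" using gen[OF IN] gen[OF H(1) spV] by simp_all
        with indep show ?thesis unfolding indep_sets2_eq by (meson subset_eq)
      qed
    qed measurable
    from indep_var_integrable[OF this intI H(2)] indep_var_lebesgue_integral[OF this intI H(2)]
    show ?thesis by (simp add: I_def)
  qed
  have "AE \<omega> in M. ts \<omega> \<le> T"
  proof (rule AE_prob_1[THEN eventually_mono])
    have "prob {\<omega> \<in> space M. ts \<omega> \<le> T} = prob (\<Union>t\<in>{..T}. {\<omega> \<in> space M. ts \<omega> = t})"
      by (rule arg_cong[where f = prob]) auto
    also have "\<dots> = (\<Sum>t\<le>T. prob {\<omega> \<in> space M. ts \<omega> = t})"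
      by (rule finite_measure_finite_Union) (auto simp: disjoint_family_on_def)
    also have "\<dots> = 1" using p by simp
    finally show "prob {\<omega> \<in> space M. ts \<omega> \<le> T} = 1" .
  qed auto
  then have "AE \<omega> in M. H (ts \<omega>) \<omega> = (\<Sum>t\<le>T. I t \<omega> * H t \<omega>)"
    using AE_space
  proof eventually_elim
    fix \<omega> assume *: "ts \<omega> \<le> T" "\<omega> \<in> space M"
    have "(\<Sum>t\<le>T. I t \<omega> * H t \<omega>) = (\<Sum>t\<in>{ts \<omega>}. I t \<omega> * H t \<omega>)"
      using * by (intro sum.mono_neutral_right) (auto simp: I_def)
    then show "H (ts \<omega>) \<omega> = (\<Sum>t\<le>T. I t \<omega> * H t \<omega>)" using * by (simp add: I_def)
  qed
  then have "(\<integral>\<omega>. H (ts \<omega>) \<omega> \<partial>M) = (\<integral>\<omega>. (\<Sum>t\<le>T. I t \<omega> * H t \<omega>) \<partial>M)"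
    by (intro integral_cong_AE measurable_compose_countable[OF HM ts]) measurable
  also have "\<dots> = (\<Sum>t\<le>T. measure M {\<omega> \<in> space M. ts \<omega> = t} * (\<integral>\<omega>. H t \<omega> \<partial>M))"
    using prod by (subst Bochner_Integration.integral_sum) auto
  also have "\<dots> = (\<Sum>t\<le>T. p t * (\<integral>\<omega>. H t \<omega> \<partial>M))" using p by (intro sum.cong) auto
  finally show ?thesis .
qed

lemma weighted_average_le_of_descent:
  fixes a I \<alpha> :: "nat \<Rightarrow> real"
  assumes step: "\<And>t. a (Suc t) \<le> a t + K * (\<alpha> t)\<^sup>2 - \<kappa> * (\<alpha> t * I t)"
    and "\<And>t. m \<le> a t" "\<And>t. 0 < \<alpha> t" "0 < \<kappa>"
  shows "1 / (\<Sum>t\<le>T. \<alpha> t) * (\<Sum>t\<le>T. \<alpha> t * I t)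
    \<le> 1 / \<kappa> * ((a 0 - m + K * (\<Sum>t\<le>T. (\<alpha> t)\<^sup>2)) / (\<Sum>t\<le>T. \<alpha> t))"
proof -
  have "\<kappa> * (\<Sum>t\<le>T. \<alpha> t * I t) \<le> a 0 - a (Suc T) + K * (\<Sum>t\<le>T. (\<alpha> t)\<^sup>2)"
  proof (induction T)
    case 0 then show ?case using step[of 0] by simp
  next
    case (Suc T) then show ?case using step[of "Suc T"] by (simp add: algebra_simps)
  qed
  also have "\<dots> \<le> a 0 - m + K * (\<Sum>t\<le>T. (\<alpha> t)\<^sup>2)" using assms(2) by simp
  finally have *: "(\<Sum>t\<le>T. \<alpha> t * I t) \<le> 1 / \<kappa> * (a 0 - m + K * (\<Sum>t\<le>T. (\<alpha> t)\<^sup>2))"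
    using assms(4) by (simp add: field_simps)
  have "0 < (\<Sum>t\<le>T. \<alpha> t)" using assms(3) by (intro sum_pos) auto
  then show ?thesis using divide_right_mono[OF *, of "\<Sum>t\<le>T. \<alpha> t"] by simp
qed

section \<open>Convergence of the proximal derivative-free method\<close>

theorem theorem1:
  fixes f r \<Phi> :: "real ^ 'n \<Rightarrow> real"
    and F :: "real ^ 'n \<Rightarrow> 's \<Rightarrow> real"
    and P :: "'s measure"
    and M :: "'w measure"
    and \<xi> :: "nat \<Rightarrow> 'w \<Rightarrow> 's"
    and Z1 Z2 x g e :: "nat \<Rightarrow> 'w \<Rightarrow> real ^ 'n"
    and x0 :: "real ^ 'n"
    and \<alpha> u1 u2 :: "nat \<Rightarrow> real"
    and fu \<Phi>u :: "nat \<Rightarrow> real ^ 'n \<Rightarrow> real"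
    and \<rho> \<rho>b L0 E \<sigma> Bb :: real
  assumes "prob_space P" and "prob_space M"
    \<comment> \<open>the problem\<close>
    and "\<Phi> = (\<lambda>y. f y + r y)"
    and min_exists: "\<exists>y. \<forall>z. \<Phi> y \<le> \<Phi> z"
    and "convex_on UNIV r"
    and "0 < \<rho>" and "weakly_convex \<rho> f"
    and "uniformly_locally_lipschitz L0 f"
    and "(\<lambda>(y, s). F y s) \<in> borel_measurable (borel \<Otimes>\<^sub>M P)"
    and "\<And>y. integrable P (F y)"
    and "\<And>y. f y = (\<integral>s. F y s \<partial>P)"
    \<comment> \<open>step sizes and smoothing parameters\<close>
    and "\<And>t. 0 < \<alpha> t" and "decseq \<alpha>" and "\<alpha> \<longlonglongrightarrow> 0"
    and "u1 = (\<lambda>t. (\<alpha> t)\<^sup>2)" and "u2 = (\<lambda>t. \<alpha> t ^ 3)"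
    and "\<And>t. u2 t \<le> u1 t / 2"
    and "\<rho> < \<rho>b" and "\<And>t. \<alpha> t < min (1 / \<rho>b) ((\<rho>b - \<rho>) / 2)"
    and "fu = (\<lambda>t. gaussian_smoothing (u1 t) f)"
    and "\<Phi>u = (\<lambda>t y. fu t y + r y)"
    \<comment> \<open>laws and independence: the triples are independent over time, and each triple has the
      product law\<close>
    and "prob_space.indep_vars M (\<lambda>_. P \<Otimes>\<^sub>M borel \<Otimes>\<^sub>M borel)
           (\<lambda>t \<omega>. (\<xi> t \<omega>, Z1 t \<omega>, Z2 t \<omega>)) UNIV"
    and "\<And>t. distr M (P \<Otimes>\<^sub>M borel \<Otimes>\<^sub>M borel) (\<lambda>\<omega>. (\<xi> t \<omega>, Z1 t \<omega>, Z2 t \<omega>))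
           = P \<Otimes>\<^sub>M std_gaussian \<Otimes>\<^sub>M std_gaussian"
    \<comment> \<open>the algorithm\<close>
    and "\<And>t \<omega>. g t \<omega> =
           ((F (x t \<omega> + u1 t *\<^sub>R Z1 t \<omega> + u2 t *\<^sub>R Z2 t \<omega>) (\<xi> t \<omega>)
             - F (x t \<omega> + u1 t *\<^sub>R Z1 t \<omega>) (\<xi> t \<omega>)) / u2 t) *\<^sub>R Z2 t \<omega>"
    and "\<And>\<omega>. x 0 \<omega> = x0"
    and "\<And>t \<omega>. x (Suc t) \<omega> = prox (\<alpha> t) r (x t \<omega> - \<alpha> t *\<^sub>R g t \<omega>)"
    \<comment> \<open>standing properties of the estimator and of the smoothing\<close>
    and "0 < E" and "0 < \<sigma>" and "0 < Bb"
    and estimator_bias: "\<And>t. AE \<omega> in M. norm (e t \<omega>) \<le> E \<and>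
           vec_cond_exp M (history M x t) (g t) \<omega>
             = gradient (fu t) (x t \<omega>) + (u2 t / u1 t) *\<^sub>R e t \<omega>"
    and estimator_variance: "\<And>t. AE \<omega> in M.
           nn_cond_exp M (history M x t)
             (\<lambda>\<omega>'. ennreal ((norm (g t \<omega>' - gradient (fu t) (x t \<omega>')))\<^sup>2)) \<omega> \<le> ennreal \<sigma>"
    and smoothing_bounds: "\<And>t y. f y \<le> fu t y \<and>
           fu t y \<le> f y + u1 t * Bb * sqrt (real CARD('n) + 2)"
  shows "\<exists>B::real.
    (\<forall>t.
      integrable M (\<lambda>\<omega>. moreau \<rho>b \<Phi> (x t \<omega>)) \<and>
      integrable M (\<lambda>\<omega>. (norm (gradient (moreau \<rho>b (\<Phi>u t)) (x t \<omega>)))\<^sup>2) \<and>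
      (\<integral>\<omega>. moreau \<rho>b \<Phi> (x (Suc t) \<omega>) \<partial>M)
        \<le> (\<integral>\<omega>. moreau \<rho>b \<Phi> (x t \<omega>) \<partial>M)
          + (\<alpha> t)\<^sup>2 * Bb * sqrt (real CARD('n) + 2) + B * \<rho>b / 2 * (\<alpha> t)\<^sup>2
          - \<alpha> t * (\<rho>b - \<rho>) / (2 * \<rho>b)
            * (\<integral>\<omega>. (norm (gradient (moreau \<rho>b (\<Phi>u t)) (x t \<omega>)))\<^sup>2 \<partial>M)) \<and>
    (\<forall>T.
      (\<forall>ts :: 'w \<Rightarrow> nat.
        ts \<in> measurable M (count_space UNIV) \<and>
        (\<forall>t\<le>T. measure M {\<omega> \<in> space M. ts \<omega> = t} = \<alpha> t / (\<Sum>i\<le>T. \<alpha> i)) \<and>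
        prob_space.indep_set M
          (sets (vimage_algebra (space M) ts (count_space UNIV)))
          (sets (vimage_algebra (space M) (\<lambda>\<omega> t. (\<xi> t \<omega>, Z1 t \<omega>, Z2 t \<omega>))
            (\<Pi>\<^sub>M t\<in>UNIV. P \<Otimes>\<^sub>M borel \<Otimes>\<^sub>M borel)))
        \<longrightarrow>
        (\<integral>\<omega>. (norm (gradient (moreau \<rho>b (\<Phi>u (ts \<omega>))) (x (ts \<omega>) \<omega>)))\<^sup>2 \<partial>M)
          = 1 / (\<Sum>t\<le>T. \<alpha> t) * (\<Sum>t\<le>T. \<alpha> t *
              (\<integral>\<omega>. (norm (gradient (moreau \<rho>b (\<Phi>u t)) (x t \<omega>)))\<^sup>2 \<partial>M))) \<and>
      1 / (\<Sum>t\<le>T. \<alpha> t) * (\<Sum>t\<le>T. \<alpha> t *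
          (\<integral>\<omega>. (norm (gradient (moreau \<rho>b (\<Phi>u t)) (x t \<omega>)))\<^sup>2 \<partial>M))
        \<le> 2 * \<rho>b / (\<rho>b - \<rho>) *
          ((\<Phi>u 0 x0 - (INF y. \<Phi> y)
             + (Bb * sqrt (real CARD('n) + 2) + B * \<rho>b / 2) * (\<Sum>t\<le>T. (\<alpha> t)\<^sup>2))
           / (\<Sum>t\<le>T. \<alpha> t)))"
proof -
  note \<Phi>_eq = assms(3) and r_convex = assms(5) and f_wc = assms(7) and f_lip = assms(8)
  note \<alpha>_pos = assms(12) and u1_eq = assms(15) and u2_eq = assms(16)
  note \<rho>_less = assms(18) and \<alpha>_less = assms(19) and fu_eq = assms(20) and \<Phi>u_eq = assms(21)
  note g_eq = assms(24) and x_0 = assms(25) and x_Suc = assms(26)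
  interpret prob_space M by fact
  have \<rho>b: "0 < \<rho>b" using assms(6) \<rho>_less by simp
  have \<alpha>: "\<alpha> t * \<rho>b \<le> 1" "\<alpha> t \<le> (\<rho>b - \<rho>) / 2" for t
    using \<alpha>_less[of t] \<rho>b by (simp_all add: field_simps)
  have L0: "0 \<le> L0" by (rule uniformly_locally_lipschitz_nonneg[OF f_lip])
  note lip = uniformly_locally_lipschitz_imp_lipschitz[OF f_lip]

  have fu_wc: "weakly_convex \<rho> (fu t)" for t
    unfolding fu_eq by (rule weakly_convex_gaussian_smoothing[OF L0 lip f_wc])
  have u1_pos: "0 < u1 t" for t using \<alpha>_pos[of t] by (simp add: u1_eq)
  have fu_gderiv: "GDERIV (fu t) y :> gradient (fu t) y" for t y
  proof -
    note D = gaussian_smoothing_gderiv[OF L0 lip u1_pos[of t], of y]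
    show ?thesis unfolding fu_eq gradient_eqI[OF D] by (rule D)
  qed
  have fu_grad: "norm (gradient (fu t) y) \<le> L0" for t y
    using gaussian_smoothing_lipschitz[OF L0 lip] unfolding fu_eq
    by (intro norm_gradient_le_lipschitz[OF L0 _ fu_gderiv[unfolded fu_eq]])
  have \<Phi>_wc: "weakly_convex \<rho> \<Phi>" unfolding \<Phi>_eq by (rule weakly_convex_add_convex[OF f_wc r_convex])
  have \<Phi>u_wc: "weakly_convex \<rho> (\<Phi>u t)" for t
    unfolding \<Phi>u_eq by (rule weakly_convex_add_convex[OF fu_wc r_convex])
  obtain y0 where y0: "\<And>z. \<Phi> y0 \<le> \<Phi> z" using min_exists by blast
  then have INF_\<Phi>: "(INF y. \<Phi> y) = \<Phi> y0" by (intro cInf_eq_minimum) auto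

  have triple: "(\<lambda>\<omega>. (\<xi> t \<omega>, Z1 t \<omega>, Z2 t \<omega>)) \<in> measurable M (P \<Otimes>\<^sub>M borel \<Otimes>\<^sub>M borel)" for t
    using assms(22) unfolding indep_vars_def by simp
  note iterates_meas = prox_iterates_measurable[OF assms(9) r_convex \<alpha>_pos _ g_eq x_0 x_Suc]
  note x_meas = iterates_meas(1)[OF triple] and g_meas = iterates_meas(2)[OF triple]

  define c where "c t = u1 t * Bb * sqrt (real CARD('n) + 2)" for t
  define B where "B = E\<^sup>2 + 2 * \<sigma> + 8 * L0\<^sup>2"
  define H where "H t \<omega> = (norm (gradient (moreau \<rho>b (\<Phi>u t)) (x t \<omega>)))\<^sup>2" for t \<omega>
  have descent: "integrable M (\<lambda>\<omega>. moreau \<rho>b \<Phi> (x (Suc t) \<omega>)) \<and> integrable M (H t) \<and>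
      (\<integral>\<omega>. moreau \<rho>b \<Phi> (x (Suc t) \<omega>) \<partial>M) \<le> (\<integral>\<omega>. moreau \<rho>b \<Phi> (x t \<omega>) \<partial>M) + c t
        + B * \<rho>b / 2 * (\<alpha> t)\<^sup>2 - \<alpha> t * (\<rho>b - \<rho>) / (2 * \<rho>b) * (\<integral>\<omega>. H t \<omega> \<partial>M)"
    if int: "integrable M (\<lambda>\<omega>. moreau \<rho>b \<Phi> (x t \<omega>))" for t
  proof -
    have bias: "AE \<omega> in M. norm (e t \<omega>) \<le> E \<and>
        vec_cond_exp M (history M x t) (g t) \<omega> = gradient (fu t) (x t \<omega>) + \<alpha> t *\<^sub>R e t \<omega>"
      using estimator_bias[of t] \<alpha>_pos[of t]
      by (simp add: u1_eq u2_eq power2_eq_square power3_eq_cube)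
    have sandwich: "\<Phi> y \<le> fu t y + r y" "fu t y + r y \<le> \<Phi> y + c t" for y
      using smoothing_bounds[of y t] by (simp_all add: \<Phi>_eq c_def)
    have E: "0 \<le> E" "0 \<le> \<sigma>" using assms(27,28) by simp_all
    note D = expected_moreau_descent[OF \<open>prob_space M\<close> subalgebra_history[OF x_meas]
        history_measurable[OF order_refl] g_meas fu_wc r_convex \<Phi>_wc sandwich y0 fu_gderiv fu_grad
        less_imp_le[OF assms(6)] \<rho>_less \<alpha>_pos \<alpha> E bias estimator_variance int]
    show ?thesis using D unfolding x_Suc B_def H_def \<Phi>u_eq by simp
  qed
  have int: "integrable M (\<lambda>\<omega>. moreau \<rho>b \<Phi> (x t \<omega>))" for t
  proof (induction t)
    case 0 then show ?case by (simp add: x_0)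
  next
    case (Suc t) then show ?case using descent by blast
  qed
  note intH = descent[OF int, THEN conjunct2, THEN conjunct1]
  note desc = descent[OF int, THEN conjunct2, THEN conjunct2]

  \<comment> \<open>The iterates are functions of the samples, hence measurable for the \<open>\<sigma>\<close>-algebra of all samples.\<close>
  define V where "V = vimage_algebra (space M) (\<lambda>\<omega> t. (\<xi> t \<omega>, Z1 t \<omega>, Z2 t \<omega>))
      (\<Pi>\<^sub>M t\<in>UNIV. P \<Otimes>\<^sub>M borel \<Otimes>\<^sub>M borel)"
  have triples: "(\<lambda>\<omega> t. (\<xi> t \<omega>, Z1 t \<omega>, Z2 t \<omega>)) \<in> measurable M (\<Pi>\<^sub>M t\<in>UNIV. P \<Otimes>\<^sub>M borel \<Otimes>\<^sub>M borel)"
    using triple by (intro measurable_PiM_single') (auto dest: measurable_space)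
  have V_sub: "subalgebra M V" unfolding subalgebra_def V_def
    using sets_image_in_sets[OF refl triples] by simp
  have triple_V: "(\<lambda>\<omega>. (\<xi> t \<omega>, Z1 t \<omega>, Z2 t \<omega>)) \<in> measurable V (P \<Otimes>\<^sub>M borel \<Otimes>\<^sub>M borel)" for t
  proof -
    have "(\<lambda>\<omega> t. (\<xi> t \<omega>, Z1 t \<omega>, Z2 t \<omega>)) \<in> measurable V (\<Pi>\<^sub>M t\<in>UNIV. P \<Otimes>\<^sub>M borel \<Otimes>\<^sub>M borel)"
      unfolding V_def using measurable_space[OF triples] by (intro measurable_vimage_algebra1) auto
    from measurable_compose[OF this measurable_component_singleton[of t]] show ?thesis by simp
  qed
  have H_V: "H t \<in> borel_measurable V" for t
  proof -
    note [measurable] = iterates_meas(1)[OF triple_V, of t] gradient_moreau_measurable[OF \<Phi>u_wc[of t] \<rho>_less \<rho>b]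
    show ?thesis unfolding H_def by measurable
  qed
  have \<alpha>_sum: "0 < (\<Sum>t\<le>T. \<alpha> t)" for T using \<alpha>_pos by (intro sum_pos) auto
  have sampled: "(\<integral>\<omega>. H (ts \<omega>) \<omega> \<partial>M)
      = 1 / (\<Sum>t\<le>T. \<alpha> t) * (\<Sum>t\<le>T. \<alpha> t * (\<integral>\<omega>. H t \<omega> \<partial>M))"
    if "ts \<in> measurable M (count_space UNIV)"
      "\<forall>t\<le>T. measure M {\<omega> \<in> space M. ts \<omega> = t} = \<alpha> t / (\<Sum>i\<le>T. \<alpha> i)"
      "indep_set (sets (vimage_algebra (space M) ts (count_space UNIV))) (sets V)" for T ts
  proof -
    have "(\<Sum>t\<le>T. \<alpha> t / (\<Sum>i\<le>T. \<alpha> i)) = 1"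
      using \<alpha>_sum[of T] by (simp add: sum_divide_distrib[symmetric])
    then have "(\<integral>\<omega>. H (ts \<omega>) \<omega> \<partial>M)
        = (\<Sum>t\<le>T. \<alpha> t / (\<Sum>i\<le>T. \<alpha> i) * (\<integral>\<omega>. H t \<omega> \<partial>M))"
      using that by (intro integral_at_random_index[OF \<open>prob_space M\<close> V_sub H_V intH]) auto
    then show ?thesis by (simp add: sum_divide_distrib)
  qed

  define a where "a t = (\<integral>\<omega>. moreau \<rho>b \<Phi> (x t \<omega>) \<partial>M)" for t
  define K where "K = Bb * sqrt (real CARD('n) + 2) + B * \<rho>b / 2"
  have a_step: "a (Suc t) \<le> a t + K * (\<alpha> t)\<^sup>2 - (\<rho>b - \<rho>) / (2 * \<rho>b) * (\<alpha> t * (\<integral>\<omega>. H t \<omega> \<partial>M))" for t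
    using desc[of t] by (simp add: a_def K_def c_def u1_eq algebra_simps)
  have a_lower: "\<Phi> y0 \<le> a t" for t
  proof -
    have "\<Phi> y0 \<le> moreau \<rho>b \<Phi> y" for y
      unfolding moreau_eq_prox[OF \<Phi>_wc \<rho>_less \<rho>b] using y0 \<rho>b by (simp add: add_increasing2)
    then have "(\<integral>\<omega>. \<Phi> y0 \<partial>M) \<le> a t" unfolding a_def using int by (intro integral_mono) auto
    then show ?thesis by (simp add: prob_space)
  qed
  have a_0: "a 0 \<le> \<Phi>u 0 x0"
    using moreau_le[OF \<Phi>_wc \<rho>_less \<rho>b, of x0 x0] smoothing_bounds[of x0 0]
    by (simp add: a_def x_0 prob_space \<Phi>_eq \<Phi>u_eq)
  have average: "1 / (\<Sum>t\<le>T. \<alpha> t) * (\<Sum>t\<le>T. \<alpha> t * (\<integral>\<omega>. H t \<omega> \<partial>M))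
      \<le> 2 * \<rho>b / (\<rho>b - \<rho>) * ((\<Phi>u 0 x0 - \<Phi> y0 + K * (\<Sum>t\<le>T. (\<alpha> t)\<^sup>2)) / (\<Sum>t\<le>T. \<alpha> t))" for T
  proof -
    have "1 / (\<Sum>t\<le>T. \<alpha> t) * (\<Sum>t\<le>T. \<alpha> t * (\<integral>\<omega>. H t \<omega> \<partial>M))
      \<le> 1 / ((\<rho>b - \<rho>) / (2 * \<rho>b)) * ((a 0 - \<Phi> y0 + K * (\<Sum>t\<le>T. (\<alpha> t)\<^sup>2)) / (\<Sum>t\<le>T. \<alpha> t))"
      using \<rho>_less \<rho>b by (intro weighted_average_le_of_descent a_step a_lower \<alpha>_pos) simp
    also have "\<dots> \<le> 1 / ((\<rho>b - \<rho>) / (2 * \<rho>b))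
        * ((\<Phi>u 0 x0 - \<Phi> y0 + K * (\<Sum>t\<le>T. (\<alpha> t)\<^sup>2)) / (\<Sum>t\<le>T. \<alpha> t))"
      using \<rho>_less \<rho>b a_0 \<alpha>_sum[of T] by (intro mult_left_mono divide_right_mono) auto
    finally show ?thesis by simp
  qed
  have step_bound: "(\<integral>\<omega>. moreau \<rho>b \<Phi> (x (Suc t) \<omega>) \<partial>M)
        \<le> (\<integral>\<omega>. moreau \<rho>b \<Phi> (x t \<omega>) \<partial>M)
          + (\<alpha> t)\<^sup>2 * Bb * sqrt (real CARD('n) + 2) + B * \<rho>b / 2 * (\<alpha> t)\<^sup>2
          - \<alpha> t * (\<rho>b - \<rho>) / (2 * \<rho>b) * (\<integral>\<omega>. H t \<omega> \<partial>M)" for t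
    using desc[of t] by (simp add: c_def u1_eq)
  show ?thesis
    using int intH step_bound sampled average
    unfolding H_def[abs_def] V_def K_def INF_\<Phi>
    by (intro exI[of _ B] conjI allI impI) blast+
qed

end
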